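(* Let $0\le\theta<1$, let $p\ge1$ and $s$ be integers, and let $\tau=i(s+\tfrac{p\theta}{2})$ (that is, $\tau=r+i(s+\tfrac{p\theta}{2})$ with $r=0$), where $\mathrm{Im}(\tau)>0$. (i) If $s\neq0$, then the map $T:\mathbb{C}^p\to\mathbb{C}^p$ given by $$(Tw)_n=w_{-sn\bmod p}$$ is invertible (in fact unitary), and $\mathrm{id}_{\mathcal{S}(\mathbb{R})}\otimes T$ is a right $A_\theta^\infty$-module isomorphism between $\mathcal{H}_{\tau,p}$, with the module structure $\blacktriangleleft$, and the Heisenberg module $\mathcal{E}_{p,s}$. (ii) If $s=0$, then the module $\mathcal{H}_{\tau,1}$ (the case $p=1$) coincides with $\mathcal{E}_{1,0}$.
   Context: $A_\theta$ is the universal unital $C^*$-algebra generated by two unitaries $U,V$ with $UV=e^{2\pi i\theta}VU$. $A_\theta^\infty$ is the subalgebra of series $\sum_{m,n\in\mathbb{Z}}a_{m,n}U^mV^n$ with rapidly decreasing coefficients. $\mathcal{S}(\mathbb{R})$ is the space of Schwartz functions on $\mathbb{R}$. For $a,b\in\mathbb{R}$, the Weyl operator is $\{W(a,b)\psi\}(t)=e^{-\pi iab}e^{2\pi ibt}\psi(t-a)$. Components of $w\in\mathbb{C}^p$ are indexed by residues $n$ mod $p$. The clock and shift matrices are $(Cw)_n=e^{2\pi in/p}w_n$ and $(Sw)_n=w_{n-1\bmod p}$ ($C=S=1$ if $p=1$). Heisenberg module: $\mathcal{E}_{p,s}:=\mathcal{S}(\mathbb{R})\otimes\mathbb{C}^p$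 with right $A_\theta^\infty$-action $$\psi\triangleleft U=\{W(\tfrac sp+\theta,0)\otimes(S^* )^s\}\psi,\qquad \psi\triangleleft V=\{W(0,1)\otimes C\}\psi.$$ The module $\mathcal{H}_{\tau,p}$: write $\tau=i\omega_y$, $\omega_y=s+\frac{p\theta}{2}$, and identify $z=x+iy$ with $(x,y)\in\mathbb{R}^2$. $\mathcal{F}_{\tau,p}$ is the set of smooth $f:\mathbb{C}\to\mathbb{C}$ with $f(z+1)=f(z)$ and $f(z+\tau)=e^{-2\pi ipx}f(z)$. It is a right $A_\theta^\infty$-module via $$(f\triangleleft U)(x,y)=e^{2\pi ix}f(x,y-\tfrac12\theta),\qquad (f\triangleleft V)(x,y)=e^{2\pi iy}f(x+\tfrac12\theta,y).$$ Every $f\in\mathcal{F}_{\tau,p}$ is uniquely of the form $f(z)=\sum_{n\in\mathbb{Z}}e^{2\pi inx}f_{[n]}(y+n\frac{\omega_y}{p})$, where $[n]=n\bmod p$ and $f_{[n]}\in\mathcal{S}(\mathbb{R})$. The map $\varphi_{\tau,p}:f\mapsto\underline f$, where $\underline f$ has component $f_{[n]}$ at the residue $n$, is a linear bijection $\mathcal{F}_{\tau,p}\to\mathcal{H}_{\tau,p}:=\mathcal{S}(\mathbb{R})\otimes\mathbb{C}^p$. Set $\underline f\blacktriangleleft a:=\varphi_{\tau,p}(\varphi_{\tau,p}^{-1}(\underline f)\triangleleft a)$. Explicitly, $\underline f\blacktriangleleft U=\{W(\frac sp+\theta,0)\otimes S\}\underline f$ and $\underline f\blacktriangleleft V=\{W(0,1)\otimes(C^*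 )^s\}\underline f$.
   Formalization: Part (i) is proved assuming p and s are coprime; without this T is not invertible (for p=s=2, (Tw)_n=w_0 for all n). The isomorphism id⊗T is taken as a map from E_{p,s} to H_{τ,p}, the direction in which it intertwines the actions. *)

theory Defs
  imports "HOL-Analysis.Analysis" "HOL-Algebra.Subrings"
begin

section \<open>Unital C*-algebras and the rotation algebra\<close>

definition complex_ring :: "complex ring" where
  "complex_ring = \<lparr>carrier = UNIV, mult = (*), one = 1, zero = 0, add = (+)\<rparr>"

record 'a cstar = "(complex, 'a) module" +
  adj :: "'a \<Rightarrow> 'a"
  nrm :: "'a \<Rightarrow> real"

(* The case distinction is needed because Metric_space asks for symmetry and non-negativity
   also off the carrier. *)
definition cstar_dist :: "'a cstar \<Rightarrow> 'a \<Rightarrow> 'a \<Rightarrow> real" where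
  "cstar_dist A x y =
     (if x \<in> carrier A \<and> y \<in> carrier A then nrm A (x \<ominus>\<^bsub>A\<^esub> y) else 0)"

abbreviation cstar_top :: "'a cstar \<Rightarrow> 'a topology" where
  "cstar_top A \<equiv> Metric_space.mtopology (carrier A) (cstar_dist A)"

(* Non-negativity, definiteness and the triangle inequality of the norm are contained in the
   assumption that cstar_dist is a metric. *)
locale unital_cstar_algebra = ring A + module complex_ring A for A :: "'a cstar" (structure) +
  assumes nontrivial: "\<one> \<noteq> \<zero>"
    and smult_mult_left:
      "\<lbrakk>x \<in> carrier A; y \<in> carrier A\<rbrakk> \<Longrightarrow> (c \<odot> x) \<otimes> y = c \<odot> (x \<otimes> y)"
    and smult_mult_right:
      "\<lbrakk>x \<in> carrier A; y \<in> carrier A\<rbrakk> \<Longrightarrow> x \<otimes> (c \<odot> y) = c \<odot> (x \<otimes> y)"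
    and adj_closed: "x \<in> carrier A \<Longrightarrow> adj A x \<in> carrier A"
    and adj_adj: "x \<in> carrier A \<Longrightarrow> adj A (adj A x) = x"
    and adj_add:
      "\<lbrakk>x \<in> carrier A; y \<in> carrier A\<rbrakk> \<Longrightarrow> adj A (x \<oplus> y) = adj A x \<oplus> adj A y"
    and adj_smult: "x \<in> carrier A \<Longrightarrow> adj A (c \<odot> x) = cnj c \<odot> adj A x"
    and adj_mult:
      "\<lbrakk>x \<in> carrier A; y \<in> carrier A\<rbrakk> \<Longrightarrow> adj A (x \<otimes> y) = adj A y \<otimes> adj A x"
    and metric: "Metric_space (carrier A) (cstar_dist A)"
    and complete: "Metric_space.mcomplete (carrier A) (cstar_dist A)"
    and nrm_smult: "x \<in> carrier A \<Longrightarrow> nrm A (c \<odot> x) = cmod c * nrm A x"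
    and nrm_mult:
      "\<lbrakk>x \<in> carrier A; y \<in> carrier A\<rbrakk> \<Longrightarrow> nrm A (x \<otimes> y) \<le> nrm A x * nrm A y"
    and cstar_identity: "x \<in> carrier A \<Longrightarrow> nrm A (adj A x \<otimes> x) = (nrm A x)\<^sup>2"

definition cstar_unitary :: "'a cstar \<Rightarrow> 'a \<Rightarrow> bool" where
  "cstar_unitary A u \<longleftrightarrow>
     u \<in> carrier A \<and> adj A u \<otimes>\<^bsub>A\<^esub> u = \<one>\<^bsub>A\<^esub> \<and> u \<otimes>\<^bsub>A\<^esub> adj A u = \<one>\<^bsub>A\<^esub>"

definition star_hom :: "'a cstar \<Rightarrow> 'b cstar \<Rightarrow> ('a \<Rightarrow> 'b) \<Rightarrow> bool" where
  "star_hom A B h \<longleftrightarrow> h \<in> ring_hom A B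
     \<and> (\<forall>c. \<forall>x\<in>carrier A. h (c \<odot>\<^bsub>A\<^esub> x) = c \<odot>\<^bsub>B\<^esub> h x)
     \<and> (\<forall>x\<in>carrier A. h (adj A x) = adj B (h x))"

definition rotation_pair :: "real \<Rightarrow> 'a cstar \<Rightarrow> 'a \<Rightarrow> 'a \<Rightarrow> bool" where
  "rotation_pair \<theta> A u v \<longleftrightarrow> cstar_unitary A u \<and> cstar_unitary A v
     \<and> u \<otimes>\<^bsub>A\<^esub> v = exp (2 * pi * \<i> * \<theta>) \<odot>\<^bsub>A\<^esub> (v \<otimes>\<^bsub>A\<^esub> u)"

definition closed_star_subalgebra :: "'a cstar \<Rightarrow> 'a set \<Rightarrow> bool" where
  "closed_star_subalgebra A D \<longleftrightarrow> subring D A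
     \<and> (\<forall>c. \<forall>x\<in>D. c \<odot>\<^bsub>A\<^esub> x \<in> D) \<and> (\<forall>x\<in>D. adj A x \<in> D) \<and> closedin (cstar_top A) D"

(* Quantifying over algebras B with carrier inside the type of A loses nothing: the C*-algebra
   generated by two unitaries is separable, so it has at most continuum many elements, and the
   type of A has at least that many because A is a nonzero complex algebra. *)
definition is_rotation_algebra :: "real \<Rightarrow> 'a cstar \<Rightarrow> 'a \<Rightarrow> 'a \<Rightarrow> bool" where
  "is_rotation_algebra \<theta> A U V \<longleftrightarrow> unital_cstar_algebra A \<and> rotation_pair \<theta> A U V
     \<and> (\<forall>D. closed_star_subalgebra A D \<and> U \<in> D \<and> V \<in> D \<longrightarrow> D = carrier A)
     \<and> (\<forall>(B :: 'a cstar) u v. unital_cstar_algebra B \<and> rotation_pair \<theta> B u v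
          \<longrightarrow> (\<exists>h. star_hom A B h \<and> h U = u \<and> h V = v))"

definition rapidly_decreasing :: "(int \<times> int \<Rightarrow> complex) \<Rightarrow> bool" where
  "rapidly_decreasing c \<longleftrightarrow>
     (\<forall>k. \<exists>C. \<forall>m n. (1 + \<bar>real_of_int m\<bar> + \<bar>real_of_int n\<bar>) ^ k * cmod (c (m, n)) \<le> C)"

(* a is the sum of the series c(m,n) U^m V^n, as an unconditional norm limit *)
definition series_sum :: "'a cstar \<Rightarrow> 'a \<Rightarrow> 'a \<Rightarrow> (int \<times> int \<Rightarrow> complex) \<Rightarrow> 'a \<Rightarrow> bool" where
  "series_sum A U V c a \<longleftrightarrow> limitin (cstar_top A)
     (\<lambda>F. \<Oplus>\<^bsub>A\<^esub>k\<in>F. c k \<odot>\<^bsub>A\<^esub> (U [^]\<^bsub>A\<^esub> fst k \<otimes>\<^bsub>A\<^esub> V [^]\<^bsub>A\<^esub> snd k))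
     a (finite_subsets_at_top UNIV)"

definition smooth_subalgebra :: "'a cstar \<Rightarrow> 'a \<Rightarrow> 'a \<Rightarrow> 'a set" where
  "smooth_subalgebra A U V = {a \<in> carrier A. \<exists>c. rapidly_decreasing c \<and> series_sum A U V c a}"

(* In a rotation algebra the coefficients of an element of the smooth subalgebra are unique. *)
definition coeffs :: "'a cstar \<Rightarrow> 'a \<Rightarrow> 'a \<Rightarrow> 'a \<Rightarrow> int \<times> int \<Rightarrow> complex" where
  "coeffs A U V a = (SOME c. rapidly_decreasing c \<and> series_sum A U V c a)"


section \<open>Right modules\<close>

record ('a, 'm) rmodule =
  mcarrier :: "'m set"
  madd :: "'m \<Rightarrow> 'm \<Rightarrow> 'm"
  mscale :: "complex \<Rightarrow> 'm \<Rightarrow> 'm"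
  mact :: "'m \<Rightarrow> 'a \<Rightarrow> 'm"

definition rmodule_iso ::
  "'a set \<Rightarrow> ('a, 'm) rmodule \<Rightarrow> ('a, 'n) rmodule \<Rightarrow> ('m \<Rightarrow> 'n) \<Rightarrow> bool" where
  "rmodule_iso R M N h \<longleftrightarrow> bij_betw h (mcarrier M) (mcarrier N)
     \<and> (\<forall>\<psi>\<in>mcarrier M. \<forall>\<phi>\<in>mcarrier M. h (madd M \<psi> \<phi>) = madd N (h \<psi>) (h \<phi>))
     \<and> (\<forall>c. \<forall>\<psi>\<in>mcarrier M. h (mscale M c \<psi>) = mscale N c (h \<psi>))
     \<and> (\<forall>\<psi>\<in>mcarrier M. \<forall>a\<in>R. h (mact M \<psi> a) = mact N (h \<psi>) a)"

definition rmodule_coincide ::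
  "'a set \<Rightarrow> ('a, 'm) rmodule \<Rightarrow> ('a, 'm) rmodule \<Rightarrow> bool" where
  "rmodule_coincide R M N \<longleftrightarrow> mcarrier M = mcarrier N
     \<and> (\<forall>\<psi>\<in>mcarrier M. \<forall>\<phi>\<in>mcarrier M. madd M \<psi> \<phi> = madd N \<psi> \<phi>)
     \<and> (\<forall>c. \<forall>\<psi>\<in>mcarrier M. mscale M c \<psi> = mscale N c \<psi>)
     \<and> (\<forall>\<psi>\<in>mcarrier M. \<forall>a\<in>R. mact M \<psi> a = mact N \<psi> a)"

definition bij_power :: "('m \<Rightarrow> 'm) \<Rightarrow> int \<Rightarrow> 'm \<Rightarrow> 'm" where
  "bij_power f k = (if 0 \<le> k then f ^^ nat k else (inv_into UNIV f) ^^ nat (- k))"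

(* The right action of the element with coefficients c when u and v are the actions of U and V:
   U^m V^n acts by first applying u^m and then v^n, and the series converges pointwise.
   The operators u and v used below are bijections of the full function space. *)
definition series_action ::
  "(('x \<Rightarrow> complex) \<Rightarrow> 'x \<Rightarrow> complex) \<Rightarrow> (('x \<Rightarrow> complex) \<Rightarrow> 'x \<Rightarrow> complex)
     \<Rightarrow> (int \<times> int \<Rightarrow> complex) \<Rightarrow> ('x \<Rightarrow> complex) \<Rightarrow> 'x \<Rightarrow> complex" where
  "series_action u v c \<psi> =
     (\<lambda>x. \<Sum>\<^sub>\<infinity>(m, n)\<in>UNIV. c (m, n) * bij_power v n (bij_power u m \<psi>) x)"


section \<open>The spaces and operators\<close>

definition schwartz :: "(real \<Rightarrow> complex) \<Rightarrow> bool" where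
  "schwartz f \<longleftrightarrow> (\<forall>k. let g = ((\<lambda>h t. vector_derivative h (at t)) ^^ k) f in
     (\<forall>t. g differentiable (at t)) \<and> (\<forall>j. bounded (range (\<lambda>t. t ^ j *\<^sub>R g t))))"

definition weyl :: "real \<Rightarrow> real \<Rightarrow> (real \<Rightarrow> complex) \<Rightarrow> real \<Rightarrow> complex" where
  "weyl a b \<psi> t = exp (- (pi * \<i> * a * b)) * exp (2 * pi * \<i> * b * t) * \<psi> (t - a)"

(* Functions on the residues mod p are p-periodic functions on the integers. *)
definition Cvec :: "int \<Rightarrow> (int \<Rightarrow> complex) set" where
  "Cvec p = {w. \<forall>n. w (n + p) = w n}"

definition Cvec_inner :: "int \<Rightarrow> (int \<Rightarrow> complex) \<Rightarrow> (int \<Rightarrow> complex) \<Rightarrow> complex" where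
  "Cvec_inner p v w = (\<Sum>n\<in>{0..<p}. cnj (v n) * w n)"

definition Cvec_linear :: "int \<Rightarrow> ((int \<Rightarrow> complex) \<Rightarrow> int \<Rightarrow> complex) \<Rightarrow> bool" where
  "Cvec_linear p T \<longleftrightarrow> T \<in> Cvec p \<rightarrow> Cvec p
     \<and> (\<forall>v\<in>Cvec p. \<forall>w\<in>Cvec p. T (\<lambda>n. v n + w n) = (\<lambda>n. T v n + T w n))
     \<and> (\<forall>c. \<forall>w\<in>Cvec p. T (\<lambda>n. c * w n) = (\<lambda>n. c * T w n))"

definition Cvec_invertible :: "int \<Rightarrow> ((int \<Rightarrow> complex) \<Rightarrow> int \<Rightarrow> complex) \<Rightarrow> bool" where
  "Cvec_invertible p T \<longleftrightarrow> Cvec_linear p T \<and> bij_betw T (Cvec p) (Cvec p)"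

definition Cvec_unitary :: "int \<Rightarrow> ((int \<Rightarrow> complex) \<Rightarrow> int \<Rightarrow> complex) \<Rightarrow> bool" where
  "Cvec_unitary p T \<longleftrightarrow> Cvec_invertible p T
     \<and> (\<forall>v\<in>Cvec p. \<forall>w\<in>Cvec p. Cvec_inner p (T v) (T w) = Cvec_inner p v w)"

definition clock :: "int \<Rightarrow> (int \<Rightarrow> complex) \<Rightarrow> int \<Rightarrow> complex" where
  "clock p w n = exp (2 * pi * \<i> * n / p) * w n"

(* the adjoint S* of the shift (S w) n = w (n - 1) *)
definition shift_adj :: "(int \<Rightarrow> complex) \<Rightarrow> int \<Rightarrow> complex" where
  "shift_adj w n = w (n + 1)"

(* T is invertible exactly when p and s are coprime. It satisfies T S^(-s) = S T and
   T C = C^(-s) T, so id \<otimes> T maps the Heisenberg module to H. *)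
definition T_op :: "int \<Rightarrow> int \<Rightarrow> (int \<Rightarrow> complex) \<Rightarrow> int \<Rightarrow> complex" where
  "T_op p s w n = w ((- s * n) mod p)"

(* S(R) \<otimes> C^p: (n, t) \<mapsto> value at t of the component at the residue n *)
definition schwartz_Cp :: "int \<Rightarrow> (int \<times> real \<Rightarrow> complex) set" where
  "schwartz_Cp p = {\<psi>. \<forall>n. schwartz (\<lambda>t. \<psi> (n, t)) \<and> (\<forall>t. \<psi> (n + p, t) = \<psi> (n, t))}"

definition tensor_op ::
  "((real \<Rightarrow> complex) \<Rightarrow> real \<Rightarrow> complex) \<Rightarrow> ((int \<Rightarrow> complex) \<Rightarrow> int \<Rightarrow> complex)
     \<Rightarrow> (int \<times> real \<Rightarrow> complex) \<Rightarrow> int \<times> real \<Rightarrow> complex" where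
  "tensor_op W M \<psi> = (\<lambda>(n, t). M (\<lambda>k. W (\<lambda>r. \<psi> (k, r)) t) n)"


section \<open>The Heisenberg module\<close>

definition E_U :: "real \<Rightarrow> int \<Rightarrow> int \<Rightarrow> (int \<times> real \<Rightarrow> complex) \<Rightarrow> int \<times> real \<Rightarrow> complex" where
  "E_U \<theta> p s = tensor_op (weyl (s / p + \<theta>) 0) (bij_power shift_adj s)"

definition E_V :: "int \<Rightarrow> (int \<times> real \<Rightarrow> complex) \<Rightarrow> int \<times> real \<Rightarrow> complex" where
  "E_V p = tensor_op (weyl 0 1) (clock p)"

definition heisenberg_module ::
  "'a cstar \<Rightarrow> 'a \<Rightarrow> 'a \<Rightarrow> real \<Rightarrow> int \<Rightarrow> int \<Rightarrow> ('a, int \<times> real \<Rightarrow> complex) rmodule" where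
  "heisenberg_module A U V \<theta> p s = \<lparr>mcarrier = schwartz_Cp p,
     madd = (\<lambda>\<psi> \<phi> x. \<psi> x + \<phi> x), mscale = (\<lambda>c \<psi> x. c * \<psi> x),
     mact = (\<lambda>\<psi> a. series_action (E_U \<theta> p s) (E_V p) (coeffs A U V a) \<psi>)\<rparr>"


section \<open>Quasi-periodic functions and the transported module\<close>

fun Ck :: "nat \<Rightarrow> (complex \<Rightarrow> complex) \<Rightarrow> bool" where
  "Ck 0 f \<longleftrightarrow> continuous_on UNIV f"
| "Ck (Suc k) f \<longleftrightarrow> (\<forall>z. f differentiable (at z))
     \<and> (\<forall>v. Ck k (\<lambda>z. frechet_derivative f (at z) v))"

(* smoothness in the real sense, with C identified with R^2 *)
definition smooth :: "(complex \<Rightarrow> complex) \<Rightarrow> bool" where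
  "smooth f \<longleftrightarrow> (\<forall>k. Ck k f)"

definition F_space :: "complex \<Rightarrow> int \<Rightarrow> (complex \<Rightarrow> complex) set" where
  "F_space \<tau> p = {f. smooth f \<and> (\<forall>z. f (z + 1) = f z)
     \<and> (\<forall>z. f (z + \<tau>) = exp (- (2 * pi * \<i> * p * Re z)) * f z)}"

definition F_U :: "real \<Rightarrow> (complex \<Rightarrow> complex) \<Rightarrow> complex \<Rightarrow> complex" where
  "F_U \<theta> f z = exp (2 * pi * \<i> * Re z) * f (Complex (Re z) (Im z - \<theta> / 2))"

definition F_V :: "real \<Rightarrow> (complex \<Rightarrow> complex) \<Rightarrow> complex \<Rightarrow> complex" where
  "F_V \<theta> f z = exp (2 * pi * \<i> * Im z) * f (Complex (Re z + \<theta> / 2) (Im z))"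

definition F_module ::
  "'a cstar \<Rightarrow> 'a \<Rightarrow> 'a \<Rightarrow> real \<Rightarrow> complex \<Rightarrow> int \<Rightarrow> ('a, complex \<Rightarrow> complex) rmodule" where
  "F_module A U V \<theta> \<tau> p = \<lparr>mcarrier = F_space \<tau> p,
     madd = (\<lambda>f g z. f z + g z), mscale = (\<lambda>c f z. c * f z),
     mact = (\<lambda>f a. series_action (F_U \<theta>) (F_V \<theta>) (coeffs A U V a) f)\<rparr>"

(* The graph of the bijection phi: f has the expansion with components g. *)
definition phi_graph ::
  "complex \<Rightarrow> int \<Rightarrow> (complex \<Rightarrow> complex) \<Rightarrow> (int \<times> real \<Rightarrow> complex) \<Rightarrow> bool" where
  "phi_graph \<tau> p f g \<longleftrightarrow> f \<in> F_space \<tau> p \<and> g \<in> schwartz_Cp p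
     \<and> (\<forall>x y. ((\<lambda>n::int. exp (2 * pi * \<i> * n * x) * g (n, y + n * Im \<tau> / p))
          has_sum f (Complex x y)) UNIV)"

definition phi :: "complex \<Rightarrow> int \<Rightarrow> (complex \<Rightarrow> complex) \<Rightarrow> int \<times> real \<Rightarrow> complex" where
  "phi \<tau> p f = (THE g. phi_graph \<tau> p f g)"

definition phi_inv :: "complex \<Rightarrow> int \<Rightarrow> (int \<times> real \<Rightarrow> complex) \<Rightarrow> complex \<Rightarrow> complex" where
  "phi_inv \<tau> p g = (THE f. phi_graph \<tau> p f g)"

definition H_module ::
  "'a cstar \<Rightarrow> 'a \<Rightarrow> 'a \<Rightarrow> real \<Rightarrow> complex \<Rightarrow> int \<Rightarrow> ('a, int \<times> real \<Rightarrow> complex) rmodule" where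
  "H_module A U V \<theta> \<tau> p = \<lparr>mcarrier = schwartz_Cp p,
     madd = (\<lambda>\<psi> \<phi> x. \<psi> x + \<phi> x), mscale = (\<lambda>c \<psi> x. c * \<psi> x),
     mact = (\<lambda>g a. phi \<tau> p (mact (F_module A U V \<theta> \<tau> p) (phi_inv \<tau> p g) a))\<rparr>"

end

theory Submission
  imports Defs
begin

text \<open>
  Put \<open>\<beta> = Im \<tau> / p = s / p + \<theta> / 2\<close> and \<open>\<alpha> = s / p + \<theta>\<close>. An element \<open>g\<close> of the transported module
  corresponds to the theta-like series \<open>f(x, y) = \<Sum>\<^sub>n e(n x) g\<^sub>n(y + n \<beta>)\<close> with \<open>e(x) = exp(2 \<pi> i x)\<close>.
  Applying \<open>c(m,n) U^m V^n\<close> to \<open>f\<close>, summing over \<open>m\<close>, \<open>n\<close> and regrouping the absolutely convergent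
  triple series by total frequency \<open>j\<close> gives the series of the same form with components
  \<open>g'\<^sub>j(t) = \<Sum>\<^sub>m\<^sub>,\<^sub>n c(m,n) e(- n j s / p) e(n t) g\<^sub>j\<^sub>-\<^sub>m(t - m \<alpha>)\<close>; these are again Schwartz, so uniqueness of
  Fourier coefficients identifies the transported action with \<open>g \<mapsto> g'\<close>. The substitution
  \<open>\<psi>\<^sub>j \<mapsto> \<psi>\<^sub>-\<^sub>s\<^sub>j\<close> turns the Heisenberg action into this formula term by term, with the same coefficients
  on both sides.
\<close>

section \<open>Powers of the generators\<close>

text \<open>The negative branch of \<open>bij_power\<close> is hidden behind
  \<open>inv_into\<close>. An additive flow makes the inverse explicit as
  \<open>\<Phi> (-1)\<close>, so powers of a generator follow once it is recognised as the time-one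
  map of a flow.\<close>

lemma bij_power_flow:
  fixes \<Phi> :: "int \<Rightarrow> 'm \<Rightarrow> 'm"
  assumes zero: "\<And>x. \<Phi> 0 x = x" and add: "\<And>a b x. \<Phi> (a + b) x = \<Phi> a (\<Phi> b x)"
  shows "bij_power (\<Phi> 1) k = \<Phi> k"
proof -
  have pos: "(\<Phi> a ^^ n) = \<Phi> (int n * a)" for n a
  proof (induction n)
    case 0
    show ?case by (simp add: zero fun_eq_iff)
  next
    case (Suc n)
    then show ?case by (simp add: fun_eq_iff distrib_right flip: add)
  qed
  have inv: "inv_into UNIV (\<Phi> 1) = \<Phi> (-1)"
  proof (rule inv_unique_comp)
    show "\<Phi> 1 \<circ> \<Phi> (-1) = id" "\<Phi> (-1) \<circ> \<Phi> 1 = id"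
      using add[of 1 "-1"] add[of "-1" 1] by (simp_all add: fun_eq_iff zero)
  qed
  show ?thesis
    by (simp add: bij_power_def pos inv)
qed

lemma bij_power_shift_adj: "bij_power shift_adj k w n = w (n + k)"
proof -
  have "shift_adj = (\<lambda>a w n. w (n + a)) 1"
    by (simp add: shift_adj_def fun_eq_iff)
  moreover have "bij_power ((\<lambda>a (w :: int \<Rightarrow> complex) n. w (n + a)) 1) k = (\<lambda>w n. w (n + k))"
    by (rule bij_power_flow) (auto simp: ac_simps)
  ultimately show ?thesis by simp
qed

text \<open>The character e(x) on real arguments; all phase bookkeeping then reduces to real
  arithmetic and reduction modulo integers.\<close>

definition cis2pi :: "real \<Rightarrow> complex" where
  "cis2pi x = exp (2 * pi * \<i> * x)"

lemma cis2pi_add: "cis2pi (x + y) = cis2pi x * cis2pi y"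
  by (simp add: cis2pi_def distrib_left exp_add)

lemma cis2pi_of_int [simp]: "cis2pi (of_int n) = 1"
  by (simp add: cis2pi_def exp_eq_1 mult.commute)

lemma cis2pi_0 [simp]: "cis2pi 0 = 1"
  by (simp add: cis2pi_def)

lemma norm_cis2pi [simp]: "norm (cis2pi x) = 1"
  by (simp add: cis2pi_def norm_exp)

lemma cis2pi_eq_iff_int: "cis2pi x = 1 \<longleftrightarrow> x \<in> \<int>"
proof
  assume "cis2pi x = 1"
  then obtain n :: int where "Im (2 * pi * \<i> * x) = of_int (2 * n) * pi"
    by (auto simp: cis2pi_def exp_eq_1)
  then have "x = of_int n" by simp
  then show "x \<in> \<int>" by simp
qed (auto elim: Ints_cases)

lemma cis2pi_add_of_int [simp]: "cis2pi (x + of_int n) = cis2pi x"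
  by (simp add: cis2pi_add)

lemma cis2pi_diff_of_int [simp]: "cis2pi (x - of_int n) = cis2pi x"
  using cis2pi_add_of_int[of x "-n"] by simp

text \<open>A Weyl operator with \<open>b = 0\<close> is a pure translation, so its powers
  accumulate no phase.\<close>

lemma bij_power_E_U:
  "bij_power (E_U \<theta> p s) m \<psi> (k, t) = \<psi> (k + m * s, t - m * (s / p + \<theta>))"
proof -
  define \<Phi> :: "int \<Rightarrow> (int \<times> real \<Rightarrow> complex) \<Rightarrow> int \<times> real \<Rightarrow> complex" where
    "\<Phi> = (\<lambda>m \<psi> (k, t). \<psi> (k + m * s, t - m * (s / p + \<theta>)))"
  have "E_U \<theta> p s = \<Phi> 1"
    by (simp add: fun_eq_iff \<Phi>_def E_U_def tensor_op_def weyl_def bij_power_shift_adj)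
  moreover have "bij_power (\<Phi> 1) m = \<Phi> m"
    by (rule bij_power_flow) (auto simp: \<Phi>_def fun_eq_iff algebra_simps add_divide_distrib)
  ultimately show ?thesis by (simp add: \<Phi>_def)
qed

lemma bij_power_E_V:
  "bij_power (E_V p) n \<psi> (k, t) = cis2pi (n * (t + k / p)) * \<psi> (k, t)"
proof -
  define \<Phi> :: "int \<Rightarrow> (int \<times> real \<Rightarrow> complex) \<Rightarrow> int \<times> real \<Rightarrow> complex" where
    "\<Phi> = (\<lambda>n \<psi> (k, t). cis2pi (n * (t + k / p)) * \<psi> (k, t))"
  have "E_V p = \<Phi> 1"
    by (auto simp: fun_eq_iff \<Phi>_def E_V_def tensor_op_def weyl_def clock_def cis2pi_add)
       (simp add: cis2pi_def)
  moreover have "bij_power (\<Phi> 1) n = \<Phi> n"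
    by (rule bij_power_flow) (auto simp: \<Phi>_def fun_eq_iff distrib_right cis2pi_add)
  ultimately show ?thesis by (simp add: \<Phi>_def)
qed

text \<open>The multiplier depends on x alone while the translation moves y alone, so powers create
  no cross phase; for \<open>F_V\<close> the roles are exchanged.\<close>

lemma bij_power_F_U:
  "bij_power (F_U \<theta>) m f (Complex x y) = cis2pi (m * x) * f (Complex x (y - m * \<theta> / 2))"
proof -
  define \<Phi> :: "int \<Rightarrow> (complex \<Rightarrow> complex) \<Rightarrow> complex \<Rightarrow> complex" where
    "\<Phi> = (\<lambda>m f z. cis2pi (m * Re z) * f (Complex (Re z) (Im z - m * \<theta> / 2)))"
  have "F_U \<theta> = \<Phi> 1"
    by (simp add: fun_eq_iff \<Phi>_def F_U_def cis2pi_def)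
  moreover have "bij_power (\<Phi> 1) m = \<Phi> m"
    by (rule bij_power_flow)
      (auto simp: \<Phi>_def fun_eq_iff distrib_right cis2pi_add diff_diff_eq add_divide_distrib)
  ultimately show ?thesis by (simp add: \<Phi>_def)
qed

lemma bij_power_F_V:
  "bij_power (F_V \<theta>) n f (Complex x y) = cis2pi (n * y) * f (Complex (x + n * \<theta> / 2) y)"
proof -
  define \<Phi> :: "int \<Rightarrow> (complex \<Rightarrow> complex) \<Rightarrow> complex \<Rightarrow> complex" where
    "\<Phi> = (\<lambda>n f z. cis2pi (n * Im z) * f (Complex (Re z + n * \<theta> / 2) (Im z)))"
  have "F_V \<theta> = \<Phi> 1"
    by (simp add: fun_eq_iff \<Phi>_def F_V_def cis2pi_def)
  moreover have "bij_power (\<Phi> 1) n = \<Phi> n"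
    by (rule bij_power_flow) (auto simp: \<Phi>_def fun_eq_iff algebra_simps cis2pi_add add_divide_distrib)
  ultimately show ?thesis by (simp add: \<Phi>_def)
qed

section \<open>Unordered series\<close>

text \<open>Termwise differentiation by a Weierstrass test: the summable \<open>M\<close> bounds the
  operator norms of the derivatives, hence their partial sums converge uniformly on
  \<open>S\<close>. A domain \<open>S\<close> is allowed because the theta series below have only
  locally uniform majorants.\<close>

lemma has_derivative_infsum:
  fixes u :: "'i::countable \<Rightarrow> 'a::real_normed_vector \<Rightarrow> 'b::banach"
  assumes inf: "infinite (UNIV :: 'i set)" and S: "convex S" "open S" "z \<in> S"
    and u: "\<And>i x. x \<in> S \<Longrightarrow> (u i has_derivative u' i x) (at x)"
    and bound: "\<And>i x h. x \<in> S \<Longrightarrow> norm (u' i x h) \<le> M i * norm h"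
    and M: "M summable_on UNIV"
    and sum: "\<And>x. x \<in> S \<Longrightarrow> (\<lambda>i. u i x) summable_on UNIV"
  shows "((\<lambda>x. \<Sum>\<^sub>\<infinity>i. u i x) has_derivative (\<lambda>h. \<Sum>\<^sub>\<infinity>i. u' i z h)) (at z)"
proof -
  \<comment> \<open>The classical result concerns series over the naturals, so the index type is
    enumerated; the value of an unordered sum does not depend on the enumeration.\<close>
  define e :: "nat \<Rightarrow> 'i" where "e = from_nat_into UNIV"
  have e: "bij e"
    unfolding e_def using bij_betw_from_nat_into[OF _ inf] by simp
  have M_nonneg: "0 \<le> M i * norm h" for i and h :: 'a
    using bound[OF \<open>z \<in> S\<close>, of i h] norm_ge_zero order_trans by blast
  have M': "summable (\<lambda>i. M (e i))"
    using M e summable_on_imp_summable summable_on_reindex_bij_betw[of e UNIV UNIV M] by blast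
  have sum_u': "(\<lambda>i. u' i x h) summable_on UNIV" if "x \<in> S" for x h
    by (rule abs_summable_summable, rule summable_on_comparison_test
        [OF summable_on_cmult_left[OF M, of "norm h"]]) (use bound[OF that] in auto)
  have reindex: "(\<lambda>i. f (e i)) sums (\<Sum>\<^sub>\<infinity>i. f i)" if "f summable_on UNIV" for f :: "'i \<Rightarrow> 'b"
    using has_sum_imp_sums that e
    by (metis has_sum_infsum has_sum_reindex_bij_betw)
  define g' where "g' x h = (\<Sum>\<^sub>\<infinity>i. u' i x h)" for x h
  have "\<exists>g. \<forall>x\<in>S. (\<lambda>i. u (e i) x) sums (g x) \<and> (g has_derivative g' x) (at x within S)"
  proof (rule has_derivative_series[OF \<open>convex S\<close>, of _ "\<lambda>i. u' (e i)" _ z])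
    show "(u (e n) has_derivative u' (e n) x) (at x within S)" if "x \<in> S" for n x
      using u[OF that] has_derivative_at_withinI by blast
    show "(\<lambda>n. u (e n) z) sums (\<Sum>\<^sub>\<infinity>i. u i z)"
      by (rule reindex[OF sum[OF \<open>z \<in> S\<close>]])
    fix \<epsilon> :: real assume "\<epsilon> > 0"
    then obtain N where N: "\<And>n. n \<ge> N \<Longrightarrow> norm (\<Sum>i. M (e (i + n))) < \<epsilon>"
      using suminf_exist_split[OF _ M'] by blast
    show "\<forall>\<^sub>F n in sequentially. \<forall>x\<in>S. \<forall>h. norm ((\<Sum>i<n. u' (e i) x h) - g' x h) \<le> \<epsilon> * norm h"
      unfolding eventually_sequentially
    proof (intro exI allI impI ballI)
      fix n x h assume n: "N \<le> n" and x: "x \<in> S"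
      have shift: "summable (\<lambda>i. M (e (i + n)))"
        using summable_ignore_initial_segment[OF M', of n] .
      have s: "(\<lambda>i. u' (e i) x h) sums g' x h"
        unfolding g'_def by (rule reindex[OF sum_u'[OF x]])
      then have "g' x h - (\<Sum>i<n. u' (e i) x h) = (\<Sum>i. u' (e (i + n)) x h)"
        using suminf_minus_initial_segment[of "\<lambda>i. u' (e i) x h" n] sums_summable sums_unique by metis
      then have "norm ((\<Sum>i<n. u' (e i) x h) - g' x h) = norm (\<Sum>i. u' (e (i + n)) x h)"
        by (simp add: norm_minus_commute)
      also have "\<dots> \<le> (\<Sum>i. M (e (i + n)) * norm h)"
        by (rule norm_suminf_le[OF bound[OF x] summable_mult2[OF shift]])
      also have "\<dots> = (\<Sum>i. M (e (i + n))) * norm h"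
        using suminf_mult2[OF shift] by simp
      also have "\<dots> \<le> \<epsilon> * norm h"
        using N[OF n] by (intro mult_right_mono) auto
      finally show "norm ((\<Sum>i<n. u' (e i) x h) - g' x h) \<le> \<epsilon> * norm h" .
    qed
  qed (use \<open>z \<in> S\<close> in auto)
  then obtain g where g: "\<And>x. x \<in> S \<Longrightarrow> (\<lambda>i. u (e i) x) sums g x"
    "\<And>x. x \<in> S \<Longrightarrow> (g has_derivative g' x) (at x within S)" by blast
  \<comment> \<open>So far \<open>g\<close> is just some limit function; uniqueness of sums
    identifies it with the unordered sum on \<open>S\<close>.\<close>
  have eq: "g x = (\<Sum>\<^sub>\<infinity>i. u i x)" if "x \<in> S" for x
    using g(1)[OF that] reindex[OF sum[OF that]] sums_unique2 by blast
  have "(g has_derivative g' z) (at z)"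
    using g(2)[OF \<open>z \<in> S\<close>] by (simp only: at_within_open[OF \<open>z \<in> S\<close> \<open>open S\<close>])
  then have "((\<lambda>x. \<Sum>\<^sub>\<infinity>i. u i x) has_derivative g' z) (at z)"
    by (rule has_derivative_transform_within_open[OF _ \<open>open S\<close> \<open>z \<in> S\<close>]) (rule eq)
  then show ?thesis
    unfolding g'_def .
qed

section \<open>Uniqueness of Fourier coefficients\<close>

lemma has_sum_finite_sum:
  fixes f :: "'j \<Rightarrow> 'i \<Rightarrow> 'b::{comm_monoid_add, topological_comm_monoid_add}"
  assumes "\<And>j. j \<in> J \<Longrightarrow> (f j has_sum s j) A"
  shows "((\<lambda>i. \<Sum>j\<in>J. f j i) has_sum (\<Sum>j\<in>J. s j)) A"
  using assms by (induction J rule: infinite_finite_induct) (auto intro: has_sum_add)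

text \<open>
  Averaging the identity over \<open>x = j / N\<close>, \<open>j < N\<close>, with weights \<open>e(- m x)\<close> keeps only the coefficients
  with index congruent to \<open>m\<close> modulo \<open>N\<close>; for large \<open>N\<close> all of them but \<open>a m\<close> lie in the tail.
\<close>
lemma fourier_coeff_zero:
  fixes a :: "int \<Rightarrow> complex"
  assumes a: "\<And>x. ((\<lambda>n. cis2pi (n * x) * a n) has_sum 0) UNIV"
  shows "a m = 0"
proof -
  \<comment> \<open>At \<open>x = 0\<close> the hypothesis says that \<open>a\<close> is summable,
    and for complex terms unordered summability is absolute.\<close>
  have summ: "(\<lambda>n. norm (a n)) summable_on UNIV"
    using a[of 0] summable_on_iff_abs_summable_on_complex[of a UNIV] has_sum_imp_summable by auto
  have "norm (a m) \<le> \<epsilon>" if "\<epsilon> > 0" for \<epsilon>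
  proof -
    obtain F0 where F0: "finite F0" "F0 \<subseteq> UNIV"
      "dist (\<Sum>n\<in>F0. norm (a n)) (\<Sum>\<^sub>\<infinity>n. norm (a n)) \<le> \<epsilon>"
      using infsum_finite_approximation[OF summ \<open>\<epsilon> > 0\<close>] by blast
    define F where "F = insert m F0"
    have F: "finite F" "m \<in> F" using F0 by (auto simp: F_def)
    have parts: "(\<Sum>\<^sub>\<infinity>n. norm (a n)) = (\<Sum>n\<in>F. norm (a n)) + (\<Sum>\<^sub>\<infinity>n\<in>-F. norm (a n))"
      using infsum_Un_disjoint[of "\<lambda>n. norm (a n)" F "-F"] F summ
      by (simp add: summable_on_subset)
    have "(\<Sum>n\<in>F0. norm (a n)) \<le> (\<Sum>n\<in>F. norm (a n))"
      using F by (intro sum_mono2) (auto simp: F_def)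
    then have tail: "(\<Sum>\<^sub>\<infinity>n\<in>-F. norm (a n)) \<le> \<epsilon>"
      using F0(3) parts by (simp add: dist_real_def)
    \<comment> \<open>\<open>N\<close> exceeds every distance from \<open>m\<close> within
      \<open>F\<close>, so \<open>m\<close> is the only element of \<open>F\<close> in its class
      modulo \<open>N\<close>.\<close>
    define N where "N = nat (Max ((\<lambda>n. \<bar>n - m\<bar>) ` F) + 1)"
    have le: "\<bar>n - m\<bar> \<le> Max ((\<lambda>n. \<bar>n - m\<bar>) ` F)" if "n \<in> F" for n
      using F that by (intro Max_ge) auto
    from le[OF \<open>m \<in> F\<close>] have N0: "0 < N" by (simp add: N_def)
    have N: "\<bar>n - m\<bar> < int N" if "n \<in> F" for n
      using le[OF that] by (simp add: N_def)
    \<comment> \<open>The averaged weight: a geometric sum that equals \<open>N\<close> at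
      \<open>m\<close> and vanishes on the rest of \<open>F\<close>. Outside \<open>F\<close> only
      the bound by \<open>N\<close> is used.\<close>
    define w where "w n = (\<Sum>j<N. cis2pi ((n - m) * (j / N)))" for n :: int
    have "((\<lambda>n. \<Sum>j<N. cis2pi (- m * (j / N)) * (cis2pi (n * (j / N)) * a n)) has_sum
       (\<Sum>j<N. cis2pi (- m * (j / N)) * 0)) UNIV"
      by (intro has_sum_finite_sum has_sum_cmult_right a)
    also have "(\<lambda>n. \<Sum>j<N. cis2pi (- m * (j / N)) * (cis2pi (n * (j / N)) * a n)) = (\<lambda>n. w n * a n)"
      by (simp add: w_def sum_distrib_right left_diff_distrib diff_divide_distrib
          fun_eq_iff flip: mult.assoc cis2pi_add)
    finally have hs: "((\<lambda>n. w n * a n) has_sum 0) UNIV" by simp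
    have wm: "w m = N" by (simp add: w_def)
    have w0: "w n = 0" if n: "n \<in> F" "n \<noteq> m" for n
    proof -
      let ?z = "cis2pi ((n - m) / N)"
      have "real_of_int (n - m) / N \<notin> \<int>"
      proof
        assume "real_of_int (n - m) / N \<in> \<int>"
        then obtain k :: int where "real_of_int (n - m) / N = k" by (auto elim: Ints_cases)
        then have "real_of_int (n - m) = real_of_int (k * int N)" using N0 by (simp add: field_simps)
        then have "n - m = k * int N" by (simp only: of_int_eq_iff)
        with N[OF n(1)] n(2) show False
          by (metis dvd_imp_le_int dvd_triv_right eq_iff_diff_eq_0 abs_of_nat linorder_not_less)
      qed
      then have z: "?z \<noteq> 1" by (simp add: cis2pi_eq_iff_int)
      have zpow: "?z ^ j = cis2pi ((n - m) * (j / N))" for j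
        by (induction j) (auto simp: cis2pi_add[symmetric] algebra_simps add_divide_distrib diff_divide_distrib)
      have "w n = (\<Sum>j<N. ?z ^ j)" unfolding w_def by (intro sum.cong refl zpow[symmetric])
      also have "\<dots> = (?z ^ N - 1) / (?z - 1)" using z by (rule geometric_sum)
      also have "?z ^ N = 1"
        unfolding zpow using N0 cis2pi_of_int[of "n - m"] by simp
      finally show ?thesis by simp
    qed
    have wle: "norm (w n) \<le> N" for n
      unfolding w_def by (rule order_trans[OF norm_sum]) simp
    have s2: "(\<lambda>n. norm (w n * a n)) summable_on -F"
      using has_sum_imp_summable[OF hs] summable_on_subset[of _ UNIV "-F"]
      by (simp flip: summable_on_iff_abs_summable_on_complex)
    have s3: "(\<lambda>n. N * norm (a n)) summable_on -F"
      by (intro summable_on_cmult_right summable_on_subset[OF summ]) simp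
    have "0 = (\<Sum>n\<in>F. w n * a n) + (\<Sum>\<^sub>\<infinity>n\<in>-F. w n * a n)"
      using infsum_Un_disjoint[of "\<lambda>n. w n * a n" F "-F"] F hs abs_summable_summable[OF s2]
      by (simp add: has_sum_iff)
    also have "(\<Sum>n\<in>F. w n * a n) = w m * a m"
      using F w0 by (subst sum.remove[of _ m]) auto
    finally have "N * a m = - (\<Sum>\<^sub>\<infinity>n\<in>-F. w n * a n)"
      by (simp add: wm eq_neg_iff_add_eq_0)
    then have "norm (N * a m) = norm (\<Sum>\<^sub>\<infinity>n\<in>-F. w n * a n)"
      by (simp only: norm_minus_cancel)
    also have "\<dots> \<le> (\<Sum>\<^sub>\<infinity>n\<in>-F. norm (w n * a n))"
      by (rule norm_infsum_bound[OF s2])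
    also have "\<dots> \<le> (\<Sum>\<^sub>\<infinity>n\<in>-F. N * norm (a n))"
      using wle by (intro infsum_mono[OF s2 s3]) (simp add: norm_mult mult_right_mono)
    also have "\<dots> = N * (\<Sum>\<^sub>\<infinity>n\<in>-F. norm (a n))" by (rule infsum_cmult_right')
    also have "\<dots> \<le> N * \<epsilon>" using tail by (intro mult_left_mono) auto
    finally show ?thesis using N0 by (simp add: norm_mult)
  qed
  then show ?thesis
    using dense_ge[of 0 "norm (a m)"] by simp
qed

section \<open>Summable majorants and rapidly decreasing coefficients\<close>

lemma summable_on_inverse_square_int:
  "(\<lambda>n::int. 1 / (1 + \<bar>real_of_int n\<bar>) ^ 2) summable_on UNIV"
proof -
  have nat: "(\<lambda>n::nat. 1 / (1 + real n) ^ 2) summable_on UNIV"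
  proof -
    have "summable (\<lambda>n. inverse (real (Suc n) ^ 2))"
      using inverse_power_summable[of 2, where 'a = real]
      by (subst summable_Suc_iff) simp
    then show ?thesis
      by (subst summable_on_UNIV_nonneg_real_iff) (simp_all add: inverse_eq_divide)
  qed
  have "(\<lambda>n::int. 1 / (1 + \<bar>real_of_int n\<bar>) ^ 2) summable_on range int"
    using nat by (subst summable_on_reindex) (simp_all add: o_def)
  moreover have "(\<lambda>n::int. 1 / (1 + \<bar>real_of_int n\<bar>) ^ 2) summable_on range (\<lambda>n. - int n)"
    using nat by (subst summable_on_reindex) (simp_all add: o_def inj_on_def)
  moreover have "(UNIV :: int set) = range int \<union> range (\<lambda>n. - int n)"
    using int_cases2 by blast
  ultimately show ?thesis
    by (metis summable_on_union)
qed

lemma summable_on_times: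
  fixes f :: "'a \<Rightarrow> real" and g :: "'b \<Rightarrow> real"
  assumes f: "f summable_on A" and g: "g summable_on B"
    and nonneg: "\<And>x. x \<in> A \<Longrightarrow> 0 \<le> f x" "\<And>y. y \<in> B \<Longrightarrow> 0 \<le> g y"
  shows "(\<lambda>(x, y). f x * g y) summable_on A \<times> B"
proof (rule summable_on_SigmaI[where g = "\<lambda>x. f x * infsum g B"])
  show "((\<lambda>y. case (x, y) of (x, y) \<Rightarrow> f x * g y) has_sum f x * infsum g B) B" for x
    using g by (auto intro: has_sum_cmult_right)
  show "(\<lambda>x. f x * infsum g B) summable_on A"
    using f by (rule summable_on_cmult_left)
qed (use nonneg in auto)

lemma summable_on_inverse_square_int2:
  "(\<lambda>(m::int, n::int). 1 / (1 + \<bar>real_of_int m\<bar>) ^ 2 * (1 / (1 + \<bar>real_of_int n\<bar>) ^ 2)) summable_on UNIV"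
  using summable_on_times[OF summable_on_inverse_square_int summable_on_inverse_square_int] by simp

text \<open>A factor of linear growth costs one power of the weight, and all powers are available.
  This serves both the factor n produced by differentiating e(n t) and unimodular phases.\<close>

lemma rapidly_decreasing_mult:
  assumes d: "rapidly_decreasing d"
    and le: "\<And>m n. cmod (e (m, n)) \<le> A * (1 + \<bar>real_of_int m\<bar> + \<bar>real_of_int n\<bar>) * cmod (d (m, n))"
  shows "rapidly_decreasing e"
  unfolding rapidly_decreasing_def
proof
  fix k
  from d obtain C where C: "\<And>m n. (1 + \<bar>real_of_int m\<bar> + \<bar>real_of_int n\<bar>) ^ Suc k * cmod (d (m, n)) \<le> C"
    unfolding rapidly_decreasing_def by meson
  have "(1 + \<bar>real_of_int m\<bar> + \<bar>real_of_int n\<bar>) ^ k * cmod (e (m, n)) \<le> \<bar>A\<bar> * C" for m n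
  proof -
    let ?q = "1 + \<bar>real_of_int m\<bar> + \<bar>real_of_int n\<bar>"
    have "?q ^ k * cmod (e (m, n)) \<le> ?q ^ k * (A * ?q * cmod (d (m, n)))"
      by (intro mult_left_mono le) simp
    also have "\<dots> = A * (?q ^ Suc k * cmod (d (m, n)))" by simp
    also have "\<dots> \<le> \<bar>A\<bar> * (?q ^ Suc k * cmod (d (m, n)))" by (intro mult_right_mono) auto
    also have "\<dots> \<le> \<bar>A\<bar> * C" by (intro mult_left_mono C) auto
    finally show ?thesis .
  qed
  then show "\<exists>C. \<forall>m n. (1 + \<bar>real_of_int m\<bar> + \<bar>real_of_int n\<bar>) ^ k * cmod (e (m, n)) \<le> C"
    by blast
qed

text \<open>Four powers of the weight beyond \<open>k\<close> dominate the product of the two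
  squares in the inverse-square majorant.\<close>

lemma rapidly_decreasing_summable_bound:
  assumes "rapidly_decreasing d"
  shows "\<exists>M. M summable_on UNIV \<and>
    (\<forall>m n. (1 + \<bar>real_of_int m\<bar> + \<bar>real_of_int n\<bar>) ^ k * cmod (d (m, n)) \<le> M (m, n))"
proof -
  from assms obtain C where C: "\<And>m n. (1 + \<bar>real_of_int m\<bar> + \<bar>real_of_int n\<bar>) ^ (k + 4) * cmod (d (m, n)) \<le> C"
    unfolding rapidly_decreasing_def by meson
  define M where "M = (\<lambda>(m::int, n::int). C * (1 / (1 + \<bar>real_of_int m\<bar>) ^ 2 * (1 / (1 + \<bar>real_of_int n\<bar>) ^ 2)))"
  have "M summable_on UNIV"
    using summable_on_cmult_right[OF summable_on_inverse_square_int2, of C]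
    by (simp add: M_def case_prod_unfold)
  moreover have "(1 + \<bar>real_of_int m\<bar> + \<bar>real_of_int n\<bar>) ^ k * cmod (d (m, n)) \<le> M (m, n)" for m n
  proof -
    let ?q = "1 + \<bar>real_of_int m\<bar> + \<bar>real_of_int n\<bar>"
    let ?a = "1 + \<bar>real_of_int m\<bar>" and ?b = "1 + \<bar>real_of_int n\<bar>"
    have "?q ^ k * cmod (d (m, n)) * (?a ^ 2 * ?b ^ 2) \<le> ?q ^ k * cmod (d (m, n)) * (?q ^ 2 * ?q ^ 2)"
      by (intro mult_left_mono mult_mono power_mono) auto
    also have "\<dots> = ?q ^ (k + 4) * cmod (d (m, n))"
      by (simp add: power_add power2_eq_square power4_eq_xxxx)
    also have "\<dots> \<le> C" by (rule C)
    finally show ?thesis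
      unfolding M_def by (simp add: pos_le_divide_eq)
  qed
  ultimately show ?thesis by blast
qed

section \<open>Schwartz functions\<close>

text \<open>
  Being closed under sums, this recursive form is suited to induction: the derivative of each series
  below is a sum of two series of the same shape.
\<close>
fun schwartz_upto :: "nat \<Rightarrow> (real \<Rightarrow> complex) \<Rightarrow> bool" where
  "schwartz_upto 0 f \<longleftrightarrow> True"
| "schwartz_upto (Suc k) f \<longleftrightarrow> (\<forall>t. f differentiable (at t))
     \<and> (\<forall>j. bounded (range (\<lambda>t. t ^ j *\<^sub>R f t))) \<and> schwartz_upto k (\<lambda>t. vector_derivative f (at t))"

text \<open>Iterated derivatives are peeled off from the inside, which matches the recursion of
  \<open>schwartz_upto\<close>.\<close>

lemma schwartz_iff_upto: "schwartz f \<longleftrightarrow> (\<forall>k. schwartz_upto k f)"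
proof -
  let ?D = "\<lambda>h t. vector_derivative h (at t) :: complex"
  let ?P = "\<lambda>g :: real \<Rightarrow> complex. (\<forall>t. g differentiable (at t)) \<and> (\<forall>j. bounded (range (\<lambda>t. t ^ j *\<^sub>R g t)))"
  have "schwartz_upto k f \<longleftrightarrow> (\<forall>i<k. ?P ((?D ^^ i) f))" for k
  proof (induction k arbitrary: f)
    case (Suc k)
    show ?case
      unfolding schwartz_upto.simps Suc All_less_Suc2 funpow_Suc_right o_apply by simp
  qed simp
  then show ?thesis
    unfolding schwartz_def Let_def using lessI by (simp only:) blast
qed

lemma schwartz_differentiable: "schwartz f \<Longrightarrow> f differentiable (at t)"
  using schwartz_iff_upto[of f] schwartz_upto.simps(2)[of 0 f] by blast

lemma schwartz_vector_derivative:
  "schwartz f \<Longrightarrow> schwartz (\<lambda>t. vector_derivative f (at t))"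
  unfolding schwartz_iff_upto using schwartz_upto.simps(2)[of _ f] by blast

lemma schwartz_has_vector_derivative:
  "schwartz f \<Longrightarrow> (f has_vector_derivative vector_derivative f (at t)) (at t)"
  using schwartz_differentiable vector_derivative_works by blast

text \<open>The definition bounds only pure powers of t. Since
  \<open>(1 + \<bar>t\<bar>) ^ j\<close> is at most \<open>2 ^ j * (1 + \<bar>t\<bar> ^ j)\<close>,
  the bounds for the exponents 0 and \<open>j\<close> combine.\<close>

lemma schwartz_decay:
  assumes "schwartz f"
  shows "\<exists>C. \<forall>t. (1 + \<bar>t\<bar>) ^ j * cmod (f t) \<le> C"
proof -
  have b: "bounded (range (\<lambda>t. t ^ j *\<^sub>R f t))" for j
    using assms schwartz_iff_upto[of f] schwartz_upto.simps(2)[of 0 f] by blast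
  obtain A where A: "\<And>t. cmod (f t) \<le> A"
    using b[of 0] by (auto simp: bounded_iff)
  obtain B where B: "\<And>t. \<bar>t\<bar> ^ j * cmod (f t) \<le> B"
    using b[of j] by (auto simp: bounded_iff power_abs)
  have "(1 + \<bar>t\<bar>) ^ j * cmod (f t) \<le> 2 ^ j * (A + B)" for t
  proof -
    have "(1 + \<bar>t\<bar>) ^ j \<le> (2 * max 1 \<bar>t\<bar>) ^ j" by (intro power_mono) auto
    also have "\<dots> = 2 ^ j * max 1 \<bar>t\<bar> ^ j" by (simp add: power_mult_distrib)
    also have "\<dots> \<le> 2 ^ j * (1 + \<bar>t\<bar> ^ j)" by (intro mult_left_mono) (auto simp: max_def)
    finally have "(1 + \<bar>t\<bar>) ^ j * cmod (f t) \<le> 2 ^ j * (1 + \<bar>t\<bar> ^ j) * cmod (f t)"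
      by (intro mult_right_mono) auto
    also have "\<dots> = 2 ^ j * (cmod (f t) + \<bar>t\<bar> ^ j * cmod (f t))" by (simp add: algebra_simps)
    also have "\<dots> \<le> 2 ^ j * (A + B)" by (intro mult_left_mono add_mono A B) auto
    finally show ?thesis .
  qed
  then show ?thesis by blast
qed

lemma schwartz_upto_add:
  assumes "schwartz_upto k f" "schwartz_upto k g"
  shows "schwartz_upto k (\<lambda>t. f t + g t)"
  using assms
proof (induction k arbitrary: f g)
  case (Suc k)
  then have "vector_derivative (\<lambda>t. f t + g t) (at t) = vector_derivative f (at t) + vector_derivative g (at t)" for t
    by (intro vector_derivative_at has_vector_derivative_add)
       (auto simp flip: vector_derivative_works)
  with Suc show ?case
    by (auto simp: scaleR_add_right bounded_plus_comp)
qed simp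

section \<open>Periodic families of Schwartz functions\<close>

lemma periodic_mod:
  fixes w :: "int \<Rightarrow> 'b"
  assumes "\<And>n. w (n + p) = w n"
  shows "w (n mod p) = w n"
proof -
  have nat: "w (n + int k * p) = w n" for n k
  proof (induction k)
    case (Suc k)
    then show ?case using assms[of "n + int k * p"] by (simp add: algebra_simps)
  qed simp
  have "w (n + k * p) = w n" for k
  proof (cases "0 \<le> k")
    case True
    then show ?thesis using nat[of n "nat k"] by simp
  next
    case False
    then show ?thesis using nat[of "n + k * p" "nat (-k)"] by simp
  qed
  from this[of "- (n div p)"] show ?thesis
    by (simp add: minus_div_mult_eq_mod)
qed

lemma schwartz_Cp_periodic: "g \<in> schwartz_Cp p \<Longrightarrow> g (n + p, t) = g (n, t)"
  by (simp add: schwartz_Cp_def)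

lemma schwartz_Cp_mod: "\<psi> \<in> schwartz_Cp p \<Longrightarrow> \<psi> (n mod p, t) = \<psi> (n, t)"
  using periodic_mod[of "\<lambda>n. \<psi> (n, t)" p n] by (simp add: schwartz_Cp_def)

text \<open>Periodicity leaves \<open>p\<close> distinct components, so the maximum of their
  constants is uniform in \<open>n\<close>.\<close>

lemma schwartz_Cp_decay:
  assumes \<psi>: "\<psi> \<in> schwartz_Cp p" and p: "1 \<le> p"
  shows "\<exists>C. \<forall>n t. (1 + \<bar>t\<bar>) ^ j * cmod (\<psi> (n, t)) \<le> C"
proof -
  have "\<forall>n. \<exists>C. \<forall>t. (1 + \<bar>t\<bar>) ^ j * cmod (\<psi> (n, t)) \<le> C"
    using \<psi> schwartz_decay unfolding schwartz_Cp_def by blast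
  then obtain C where C: "\<And>n t. (1 + \<bar>t\<bar>) ^ j * cmod (\<psi> (n, t)) \<le> C n"
    by metis
  have "(1 + \<bar>t\<bar>) ^ j * cmod (\<psi> (n, t)) \<le> Max (C ` {0..<p})" for n t
  proof -
    have "(1 + \<bar>t\<bar>) ^ j * cmod (\<psi> (n, t)) \<le> C (n mod p)"
      using C[of t "n mod p"] \<psi> by (simp add: schwartz_Cp_mod)
    also have "\<dots> \<le> Max (C ` {0..<p})"
      using p by (intro Max_ge) auto
    finally show ?thesis .
  qed
  then show ?thesis by blast
qed

definition Cp_deriv :: "(int \<times> real \<Rightarrow> complex) \<Rightarrow> int \<times> real \<Rightarrow> complex" where
  "Cp_deriv \<psi> = (\<lambda>(n, t). vector_derivative (\<lambda>r. \<psi> (n, r)) (at t))"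

lemma Cp_deriv_schwartz_Cp: "\<psi> \<in> schwartz_Cp p \<Longrightarrow> Cp_deriv \<psi> \<in> schwartz_Cp p"
  by (auto simp: schwartz_Cp_def Cp_deriv_def schwartz_vector_derivative)

lemma Cp_deriv_works:
  "\<psi> \<in> schwartz_Cp p \<Longrightarrow> ((\<lambda>r. \<psi> (n, r)) has_vector_derivative Cp_deriv \<psi> (n, t)) (at t)"
  by (auto simp: schwartz_Cp_def Cp_deriv_def schwartz_has_vector_derivative)

lemma cis2pi_has_vector_derivative:
  "((\<lambda>t. cis2pi (a * t)) has_vector_derivative (2 * pi * \<i> * a) * cis2pi (a * t)) (at t)"
proof -
  have "((\<lambda>t. exp (t *\<^sub>R (2 * pi * \<i> * a))) has_vector_derivative
      exp (t *\<^sub>R (2 * pi * \<i> * a)) * (2 * pi * \<i> * a)) (at t)"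
    by (rule exp_scaleR_has_vector_derivative_right)
  then show ?thesis
    by (simp add: cis2pi_def scaleR_conv_of_real mult_ac)
qed

section \<open>Series of modulated translates\<close>

text \<open>With \<open>H (m, r) = g (j - m, r)\<close> this is the summand of the
  \<open>j\<close>-th component of the transported action. The shape is stable under
  differentiation: a derivative of the exponential changes \<open>d\<close>, a derivative of the
  translate changes \<open>H\<close>.\<close>

definition translates_term ::
  "real \<Rightarrow> (int \<times> int \<Rightarrow> complex) \<Rightarrow> (int \<times> real \<Rightarrow> complex) \<Rightarrow> int \<times> int \<Rightarrow> real \<Rightarrow> complex" where
  "translates_term \<alpha> d H = (\<lambda>(m, n) t. d (m, n) * cis2pi (n * t) * H (m, t - m * \<alpha>))"

definition translates_sum ::
  "real \<Rightarrow> (int \<times> int \<Rightarrow> complex) \<Rightarrow> (int \<times> real \<Rightarrow> complex) \<Rightarrow> real \<Rightarrow> complex" where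
  "translates_sum \<alpha> d H t = (\<Sum>\<^sub>\<infinity>k. translates_term \<alpha> d H k t)"

text \<open>Growth in t is split by \<open>1 + \<bar>t\<bar> \<le> (1 + \<bar>t - m *
  \<alpha>\<bar>) * (1 + \<bar>m * \<alpha>\<bar>)\<close>: the first factor is absorbed by the
  decay of \<open>H\<close>, the second by the decay of \<open>d\<close>.\<close>

lemma translates_term_bound:
  assumes d: "rapidly_decreasing d" and H: "H \<in> schwartz_Cp p" and p: "1 \<le> p"
  shows "\<exists>M. M summable_on UNIV \<and> (\<forall>k t. (1 + \<bar>t\<bar>) ^ j * cmod (translates_term \<alpha> d H k t) \<le> M k)"
proof -
  obtain C where C: "\<And>n t. (1 + \<bar>t\<bar>) ^ j * cmod (H (n, t)) \<le> C"
    using schwartz_Cp_decay[OF H p] by meson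
  obtain M where M: "M summable_on UNIV"
      "\<And>m n. (1 + \<bar>real_of_int m\<bar> + \<bar>real_of_int n\<bar>) ^ j * cmod (d (m, n)) \<le> M (m, n)"
    using rapidly_decreasing_summable_bound[OF d] by meson
  have "(1 + \<bar>t\<bar>) ^ j * cmod (translates_term \<alpha> d H (m, n) t) \<le> ((1 + \<bar>\<alpha>\<bar>) ^ j * C) * M (m, n)" for m n t
  proof -
    let ?q = "1 + \<bar>real_of_int m\<bar> + \<bar>real_of_int n\<bar>" and ?r = "t - m * \<alpha>"
    have "1 + \<bar>t\<bar> \<le> 1 + (\<bar>?r\<bar> + \<bar>real_of_int m * \<alpha>\<bar>)" by linarith
    also have "\<dots> \<le> (1 + \<bar>?r\<bar>) * (1 + \<bar>real_of_int m * \<alpha>\<bar>)" by (simp add: distrib_left distrib_right)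
    also have "1 + \<bar>real_of_int m * \<alpha>\<bar> \<le> (1 + \<bar>\<alpha>\<bar>) * ?q"
      by (simp add: distrib_left distrib_right abs_mult mult.commute)
    finally have "1 + \<bar>t\<bar> \<le> (1 + \<bar>?r\<bar>) * ((1 + \<bar>\<alpha>\<bar>) * ?q)"
      by (simp add: mult_left_mono)
    then have "(1 + \<bar>t\<bar>) ^ j \<le> ((1 + \<bar>?r\<bar>) * ((1 + \<bar>\<alpha>\<bar>) * ?q)) ^ j"
      by (intro power_mono) auto
    then have "(1 + \<bar>t\<bar>) ^ j * cmod (translates_term \<alpha> d H (m, n) t)
        \<le> ((1 + \<bar>?r\<bar>) * ((1 + \<bar>\<alpha>\<bar>) * ?q)) ^ j * (cmod (d (m, n)) * cmod (H (m, ?r)))"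
      by (simp add: translates_term_def norm_mult mult_right_mono)
    also have "\<dots> = ((1 + \<bar>?r\<bar>) ^ j * cmod (H (m, ?r))) * ((1 + \<bar>\<alpha>\<bar>) ^ j * (?q ^ j * cmod (d (m, n))))"
      by (simp add: power_mult_distrib mult_ac)
    also have "\<dots> \<le> C * ((1 + \<bar>\<alpha>\<bar>) ^ j * M (m, n))"
    proof (rule mult_mono[OF C])
      show "(1 + \<bar>\<alpha>\<bar>) ^ j * (?q ^ j * cmod (d (m, n))) \<le> (1 + \<bar>\<alpha>\<bar>) ^ j * M (m, n)"
        by (intro mult_left_mono M) auto
      show "0 \<le> C" using C[of 0 0] order_trans[of 0 "cmod (H (0, 0))"] by simp
    qed auto
    finally show ?thesis by (simp add: mult_ac)
  qed
  then show ?thesis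
    using summable_on_cmult_right[OF M(1), of "(1 + \<bar>\<alpha>\<bar>) ^ j * C"]
    by (intro exI[of _ "\<lambda>k. ((1 + \<bar>\<alpha>\<bar>) ^ j * C) * M k"]) auto
qed

lemma translates_term_abs_summable:
  assumes d: "rapidly_decreasing d" and H: "H \<in> schwartz_Cp p" and p: "1 \<le> p"
  shows "(\<lambda>k. norm (translates_term \<alpha> d H k t)) summable_on UNIV"
proof -
  obtain M where M: "M summable_on UNIV" "\<And>k t. (1 + \<bar>t\<bar>) ^ 0 * cmod (translates_term \<alpha> d H k t) \<le> M k"
    using translates_term_bound[OF d H p, of 0] by meson
  show ?thesis
    by (rule summable_on_comparison_test[OF M(1)]) (use M(2)[of t] in auto)
qed

lemma translates_sum_has_vector_derivative:
  assumes d: "rapidly_decreasing d" and H: "H \<in> schwartz_Cp p" and p: "1 \<le> p"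
  defines "d' \<equiv> \<lambda>(m, n). 2 * pi * \<i> * real_of_int n * d (m, n)"
  shows "(translates_sum \<alpha> d H has_vector_derivative
    translates_sum \<alpha> d' H t + translates_sum \<alpha> d (Cp_deriv H) t) (at t)"
    and "rapidly_decreasing d'"
proof -
  show d': "rapidly_decreasing d'"
  proof (rule rapidly_decreasing_mult[OF d])
    fix m n :: int
    have "cmod (d' (m, n)) = 2 * pi * \<bar>real_of_int n\<bar> * cmod (d (m, n))"
      by (simp add: d'_def norm_mult)
    also have "\<dots> \<le> 2 * pi * (1 + \<bar>real_of_int m\<bar> + \<bar>real_of_int n\<bar>) * cmod (d (m, n))"
      by (intro mult_right_mono mult_left_mono) auto
    finally show "cmod (d' (m, n)) \<le> 2 * pi * (1 + \<bar>real_of_int m\<bar> + \<bar>real_of_int n\<bar>) * cmod (d (m, n))" .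
  qed
  note H' = Cp_deriv_schwartz_Cp[OF H]
  let ?u' = "\<lambda>k t. translates_term \<alpha> d' H k t + translates_term \<alpha> d (Cp_deriv H) k t"
  have deriv: "(translates_term \<alpha> d H k has_vector_derivative ?u' k t) (at t)" for k t
  proof -
    obtain m n where k: "k = (m, n)" by (cases k)
    have "((\<lambda>r. H (m, r)) \<circ> (\<lambda>t. t - m * \<alpha>) has_vector_derivative 1 *\<^sub>R Cp_deriv H (m, t - m * \<alpha>)) (at t)"
      by (intro vector_diff_chain_at Cp_deriv_works[OF H]) (auto intro!: derivative_eq_intros)
    then have "((\<lambda>t. d (m, n) * (cis2pi (n * t) * H (m, t - m * \<alpha>))) has_vector_derivative
      d (m, n) * (cis2pi (n * t) * Cp_deriv H (m, t - m * \<alpha>) +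
        (2 * pi * \<i> * real_of_int n) * cis2pi (n * t) * H (m, t - m * \<alpha>))) (at t)"
      by (intro has_vector_derivative_mult has_vector_derivative_mult_right cis2pi_has_vector_derivative)
         (simp add: o_def)
    then show ?thesis
      by (simp add: k translates_term_def d'_def algebra_simps)
  qed
  obtain M1 where M1: "M1 summable_on UNIV" "\<And>k t. (1 + \<bar>t\<bar>) ^ 0 * cmod (translates_term \<alpha> d' H k t) \<le> M1 k"
    using translates_term_bound[OF d' H p, of 0] by meson
  obtain M2 where M2: "M2 summable_on UNIV" "\<And>k t. (1 + \<bar>t\<bar>) ^ 0 * cmod (translates_term \<alpha> d (Cp_deriv H) k t) \<le> M2 k"
    using translates_term_bound[OF d H' p, of 0] by meson
  have "((\<lambda>t. \<Sum>\<^sub>\<infinity>k. translates_term \<alpha> d H k t) has_derivative (\<lambda>h. \<Sum>\<^sub>\<infinity>k. h *\<^sub>R ?u' k t)) (at t)"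
  \<comment> \<open>The majorants \<open>M1\<close> and \<open>M2\<close> do not depend on the
    point, so the whole line serves as domain.\<close>
  proof (rule has_derivative_infsum[where S = UNIV and M = "\<lambda>k. M1 k + M2 k"])
    show "infinite (UNIV :: (int \<times> int) set)"
      by (simp add: finite_prod)
    show "(translates_term \<alpha> d H k has_derivative (\<lambda>h. h *\<^sub>R ?u' k x)) (at x)" for k x
      using deriv by (simp add: has_vector_derivative_def)
    show "norm (h *\<^sub>R ?u' k x) \<le> (M1 k + M2 k) * norm h" for k x h
    proof -
      have "norm (?u' k x) \<le> M1 k + M2 k"
        using M1(2)[of x k] M2(2)[of x k] by (intro norm_triangle_le) simp
      then show ?thesis by (simp add: mult.commute mult_left_mono)
    qed
    show "(\<lambda>k. M1 k + M2 k) summable_on UNIV"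
      by (intro summable_on_add M1 M2)
    show "(\<lambda>k. translates_term \<alpha> d H k x) summable_on UNIV" for x
      by (rule abs_summable_summable[OF translates_term_abs_summable[OF d H p]])
  qed auto
  moreover have "(\<Sum>\<^sub>\<infinity>k. h *\<^sub>R ?u' k t) =
      h *\<^sub>R (translates_sum \<alpha> d' H t + translates_sum \<alpha> d (Cp_deriv H) t)" for h
    unfolding infsum_scaleR_right translates_sum_def
    by (subst infsum_add)
       (auto intro: abs_summable_summable translates_term_abs_summable[OF _ _ p] d' H H' d)
  ultimately show "(translates_sum \<alpha> d H has_vector_derivative
      translates_sum \<alpha> d' H t + translates_sum \<alpha> d (Cp_deriv H) t) (at t)"
    by (simp add: has_vector_derivative_def translates_sum_def[abs_def])
qed

text \<open>Induction on the number of derivatives, with \<open>d\<close> and \<open>H\<close>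
  generalised because each differentiation alters one of them.\<close>

lemma schwartz_translates_sum:
  assumes d: "rapidly_decreasing d" and H: "H \<in> schwartz_Cp p" and p: "1 \<le> p"
  shows "schwartz (translates_sum \<alpha> d H)"
proof -
  have "schwartz_upto k (translates_sum \<alpha> d H)" for k
    using d H
  proof (induction k arbitrary: d H)
    case (Suc k)
    note deriv = translates_sum_has_vector_derivative[OF Suc.prems p]
    have "bounded (range (\<lambda>t. t ^ j *\<^sub>R translates_sum \<alpha> d H t))" for j
    proof -
      obtain M where M: "M summable_on UNIV" "\<And>k t. (1 + \<bar>t\<bar>) ^ j * cmod (translates_term \<alpha> d H k t) \<le> M k"
        using translates_term_bound[OF Suc.prems p, of j] by meson
      have "norm (t ^ j *\<^sub>R translates_sum \<alpha> d H t) \<le> infsum M UNIV" for t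
      proof -
        have le: "norm (t ^ j *\<^sub>R translates_term \<alpha> d H k t) \<le> M k" for k
        proof -
          have "norm (t ^ j *\<^sub>R translates_term \<alpha> d H k t) \<le> (1 + \<bar>t\<bar>) ^ j * cmod (translates_term \<alpha> d H k t)"
            by (auto simp: power_abs intro!: mult_right_mono power_mono)
          with M(2)[of t k] show ?thesis by linarith
        qed
        have "norm (\<Sum>\<^sub>\<infinity>k. t ^ j *\<^sub>R translates_term \<alpha> d H k t) \<le> infsum M UNIV"
          by (rule norm_infsum_le[OF has_sum_infsum has_sum_infsum])
             (use le M(1) in \<open>auto intro!: summable_on_scaleR_right
                abs_summable_summable[OF translates_term_abs_summable[OF Suc.prems p]]\<close>)
        then show ?thesis
          by (simp only: translates_sum_def infsum_scaleR_right)
      qed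
      then show ?thesis by (auto simp: bounded_iff)
    qed
    moreover have "translates_sum \<alpha> d H differentiable (at t)" for t
      using deriv(1) by (rule differentiableI_vector)
    moreover have "schwartz_upto k (\<lambda>t. vector_derivative (translates_sum \<alpha> d H) (at t))"
      unfolding vector_derivative_at[OF deriv(1)]
      by (intro schwartz_upto_add Suc.IH deriv(2) Suc.prems Cp_deriv_schwartz_Cp)
    ultimately show ?case by simp
  qed simp
  then show ?thesis by (simp add: schwartz_iff_upto)
qed

section \<open>Theta series\<close>

lemma Ck_add: "Ck k f \<Longrightarrow> Ck k g \<Longrightarrow> Ck k (\<lambda>z. f z + g z)"
proof (induction k arbitrary: f g)
  case 0
  then show ?case by (simp add: continuous_on_add)
next
  case (Suc k)
  then have "frechet_derivative (\<lambda>z. f z + g z) (at z) v = frechet_derivative f (at z) v + frechet_derivative g (at z) v" for z v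
    by (subst frechet_derivative_at[OF has_derivative_add, symmetric])
       (auto simp flip: frechet_derivative_works)
  with Suc show ?case by simp
qed

lemma Ck_mult_const: "Ck k f \<Longrightarrow> Ck k (\<lambda>z. c * f z)"
proof (induction k arbitrary: f)
  case 0
  then show ?case by (simp add: continuous_on_mult_left)
next
  case (Suc k)
  then have "frechet_derivative (\<lambda>z. c * f z) (at z) v = c * frechet_derivative f (at z) v" for z v
    by (subst frechet_derivative_at[OF has_derivative_mult_right, symmetric])
       (auto simp flip: frechet_derivative_works)
  with Suc show ?case by simp
qed

text \<open>The case \<open>i = 0\<close> is the expansion inverse to \<open>phi\<close>. The factor
  \<open>n ^ i\<close> counts derivatives in x, up to powers of 2 pi i, while derivatives in y act
  on \<open>G\<close>; so the family contains all terms met in proving smoothness.\<close>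

definition theta_term :: "real \<Rightarrow> nat \<Rightarrow> (int \<times> real \<Rightarrow> complex) \<Rightarrow> int \<Rightarrow> complex \<Rightarrow> complex" where
  "theta_term \<beta> i G n z = of_int n ^ i * (cis2pi (n * Re z) * G (n, Im z + n * \<beta>))"

definition theta_sum :: "real \<Rightarrow> nat \<Rightarrow> (int \<times> real \<Rightarrow> complex) \<Rightarrow> complex \<Rightarrow> complex" where
  "theta_sum \<beta> i G z = (\<Sum>\<^sub>\<infinity>n. theta_term \<beta> i G n z)"

text \<open>As \<open>\<beta>\<close> is positive, \<open>n\<close> is controlled by
  \<open>Im z + n * \<beta>\<close> and \<open>Im z\<close>, so decay of \<open>G\<close> in its
  argument becomes decay in \<open>n\<close>. Of the \<open>i + 2\<close> powers, \<open>i\<close>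
  cancel \<open>n ^ i\<close> and two give summability.\<close>

lemma theta_term_bound:
  assumes G: "G \<in> schwartz_Cp p" and p: "1 \<le> p" and \<beta>: "0 < \<beta>"
  shows "\<exists>M. M summable_on UNIV \<and>
    (\<forall>n. 0 \<le> M n) \<and> (\<forall>n z. cmod (theta_term \<beta> i G n z) \<le> (1 + \<bar>Im z\<bar>) ^ (i + 2) * M n)"
proof -
  obtain C where C: "\<And>n t. (1 + \<bar>t\<bar>) ^ (i + 2) * cmod (G (n, t)) \<le> C"
    using schwartz_Cp_decay[OF G p] by meson
  have C0: "0 \<le> C" using C[of 0 0] order_trans[of 0 "cmod (G (0, 0))"] by simp
  define M where "M n = (1 + 1 / \<beta>) ^ (i + 2) * C * (1 / (1 + \<bar>real_of_int n\<bar>) ^ 2)" for n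
  have M: "M summable_on UNIV"
    unfolding M_def using summable_on_inverse_square_int by (rule summable_on_cmult_right)
  have "cmod (theta_term \<beta> i G n z) \<le> (1 + \<bar>Im z\<bar>) ^ (i + 2) * M n" for n z
  proof -
    let ?q = "1 + \<bar>real_of_int n\<bar>" and ?r = "Im z + n * \<beta>" and ?y = "1 + \<bar>Im z\<bar>"
    have "?q \<le> (1 + 1 / \<beta>) * (1 + \<bar>n * \<beta>\<bar>)"
      using \<beta> by (simp add: distrib_left distrib_right abs_mult)
    also have "1 + \<bar>n * \<beta>\<bar> \<le> 1 + (\<bar>?r\<bar> + \<bar>Im z\<bar>)" by linarith
    also have "\<dots> \<le> (1 + \<bar>?r\<bar>) * ?y" by (simp add: distrib_left distrib_right)
    finally have "?q \<le> (1 + 1 / \<beta>) * ((1 + \<bar>?r\<bar>) * ?y)"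
      using \<beta> by (simp add: mult_left_mono)
    then have "?q ^ (i + 2) \<le> ((1 + 1 / \<beta>) * ((1 + \<bar>?r\<bar>) * ?y)) ^ (i + 2)"
      by (intro power_mono) auto
    then have "?q ^ (i + 2) * cmod (G (n, ?r)) \<le> ((1 + 1 / \<beta>) * ((1 + \<bar>?r\<bar>) * ?y)) ^ (i + 2) * cmod (G (n, ?r))"
      by (intro mult_right_mono) auto
    also have "\<dots> = ((1 + 1 / \<beta>) ^ (i + 2) * ?y ^ (i + 2)) * ((1 + \<bar>?r\<bar>) ^ (i + 2) * cmod (G (n, ?r)))"
      by (simp only: power_mult_distrib mult_ac)
    also have "\<dots> \<le> ((1 + 1 / \<beta>) ^ (i + 2) * ?y ^ (i + 2)) * C"
      using \<beta> by (intro mult_left_mono C) auto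
    finally have "?q ^ (i + 2) * cmod (G (n, ?r)) \<le> ((1 + 1 / \<beta>) ^ (i + 2) * ?y ^ (i + 2)) * C" .
    moreover have "cmod (theta_term \<beta> i G n z) * ?q ^ 2 \<le> ?q ^ (i + 2) * cmod (G (n, ?r))"
    proof -
      have "cmod (theta_term \<beta> i G n z) \<le> ?q ^ i * cmod (G (n, ?r))"
        by (auto simp: theta_term_def norm_mult norm_power intro!: mult_right_mono power_mono)
      then have "cmod (theta_term \<beta> i G n z) * ?q ^ 2 \<le> ?q ^ i * cmod (G (n, ?r)) * ?q ^ 2"
        by (intro mult_right_mono) auto
      then show ?thesis by (simp only: power_add mult_ac)
    qed
    ultimately have "cmod (theta_term \<beta> i G n z) * ?q ^ 2 \<le> ((1 + 1 / \<beta>) ^ (i + 2) * ?y ^ (i + 2)) * C"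
      by linarith
    then have "cmod (theta_term \<beta> i G n z) \<le> ((1 + 1 / \<beta>) ^ (i + 2) * ?y ^ (i + 2)) * C / ?q ^ 2"
      by (subst pos_le_divide_eq) auto
    then show ?thesis
      unfolding M_def by (simp only: mult_ac times_divide_eq_right mult_1_right)
  qed
  moreover have "0 \<le> M n" for n
    using C0 \<beta> by (simp add: M_def)
  ultimately show ?thesis using M by blast
qed

lemma theta_term_abs_summable:
  assumes G: "G \<in> schwartz_Cp p" and p: "1 \<le> p" and \<beta>: "0 < \<beta>"
  shows "(\<lambda>n. norm (theta_term \<beta> i G n z)) summable_on UNIV"
proof -
  obtain M where M: "M summable_on UNIV"
    "\<And>n z. cmod (theta_term \<beta> i G n z) \<le> (1 + \<bar>Im z\<bar>) ^ (i + 2) * M n"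
    using theta_term_bound[OF assms] by meson
  show ?thesis
    by (rule summable_on_comparison_test[OF summable_on_cmult_right[OF M(1)]]) (rule M(2), simp)
qed

lemma theta_sum_has_derivative:
  assumes G: "G \<in> schwartz_Cp p" and p: "1 \<le> p" and \<beta>: "0 < \<beta>"
  shows "(theta_sum \<beta> i G has_derivative
    (\<lambda>h. (Re h * (2 * pi * \<i>)) * theta_sum \<beta> (Suc i) G z + Im h * theta_sum \<beta> i (Cp_deriv G) z)) (at z)"
proof -
  note G' = Cp_deriv_schwartz_Cp[OF G]
  let ?u' = "\<lambda>n z h. (Re h * (2 * pi * \<i>)) * theta_term \<beta> (Suc i) G n z + Im h * theta_term \<beta> i (Cp_deriv G) n z"
  have deriv: "(theta_term \<beta> i G n has_derivative ?u' n z) (at z)" for n z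
  proof -
    have 1: "((\<lambda>w. cis2pi (n * Re w)) has_derivative
        (\<lambda>h. Re h *\<^sub>R ((2 * pi * \<i> * real_of_int n) * cis2pi (n * Re z)))) (at z)"
      by (rule has_derivative_compose[OF bounded_linear_imp_has_derivative[OF bounded_linear_Re]
            cis2pi_has_vector_derivative[unfolded has_vector_derivative_def]])
    have 2: "((\<lambda>w. G (n, Im w + n * \<beta>)) has_derivative (\<lambda>h. Im h *\<^sub>R Cp_deriv G (n, Im z + n * \<beta>))) (at z)"
      by (rule has_derivative_compose[OF has_derivative_add_const
            [OF bounded_linear_imp_has_derivative[OF bounded_linear_Im]]
            Cp_deriv_works[OF G, unfolded has_vector_derivative_def]])
    show ?thesis
      unfolding theta_term_def
      by (rule has_derivative_eq_rhs[OF has_derivative_mult_right[OF has_derivative_mult[OF 1 2]]])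
         (simp add: fun_eq_iff scaleR_conv_of_real algebra_simps)
  qed
  obtain M1 where M1: "M1 summable_on UNIV" "\<And>n. 0 \<le> M1 n"
    "\<And>n z. cmod (theta_term \<beta> (Suc i) G n z) \<le> (1 + \<bar>Im z\<bar>) ^ (Suc i + 2) * M1 n"
    using theta_term_bound[OF G p \<beta>] by meson
  obtain M2 where M2: "M2 summable_on UNIV" "\<And>n. 0 \<le> M2 n"
    "\<And>n z. cmod (theta_term \<beta> i (Cp_deriv G) n z) \<le> (1 + \<bar>Im z\<bar>) ^ (i + 2) * M2 n"
    using theta_term_bound[OF G' p \<beta>] by meson
  \<comment> \<open>The majorants grow with the imaginary part, so the series is differentiated on
    the unit ball around \<open>z\<close>, where \<open>1 + \<bar>Im w\<bar>\<close> is at most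
    \<open>R\<close>.\<close>
  define R where "R = 1 + (\<bar>Im z\<bar> + 1)"
  define M where "M n = 2 * pi * (R ^ (Suc i + 2) * M1 n) + R ^ (i + 2) * M2 n" for n
  have "((\<lambda>z. \<Sum>\<^sub>\<infinity>n. theta_term \<beta> i G n z) has_derivative (\<lambda>h. \<Sum>\<^sub>\<infinity>n. ?u' n z h)) (at z)"
  proof (rule has_derivative_infsum[where S = "ball z 1" and M = M])
    show "norm (?u' n w h) \<le> M n * norm h" if "w \<in> ball z 1" for n w h
    proof -
      have "\<bar>Im w - Im z\<bar> \<le> cmod (w - z)"
        using abs_Im_le_cmod[of "w - z"] by simp
      then have R: "1 + \<bar>Im w\<bar> \<le> R"
        using that by (simp add: R_def dist_norm norm_minus_commute)
      have "cmod (theta_term \<beta> (Suc i) G n w) \<le> R ^ (Suc i + 2) * M1 n"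
        using R by (intro order_trans[OF M1(3)] mult_right_mono power_mono M1(2)) auto
      moreover have "cmod (theta_term \<beta> i (Cp_deriv G) n w) \<le> R ^ (i + 2) * M2 n"
        using R by (intro order_trans[OF M2(3)] mult_right_mono power_mono M2(2)) auto
      ultimately have "\<bar>Re h\<bar> * (2 * pi) * cmod (theta_term \<beta> (Suc i) G n w) + \<bar>Im h\<bar> * cmod (theta_term \<beta> i (Cp_deriv G) n w)
        \<le> norm h * (2 * pi) * (R ^ (Suc i + 2) * M1 n) + norm h * (R ^ (i + 2) * M2 n)"
        by (intro add_mono mult_mono abs_Re_le_cmod abs_Im_le_cmod) auto
      then show ?thesis
        by (intro norm_triangle_le) (simp add: norm_mult M_def algebra_simps)
    qed
    show "M summable_on UNIV"
      unfolding M_def by (intro summable_on_add summable_on_cmult_right M1 M2)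
    show "(\<lambda>n. theta_term \<beta> i G n w) summable_on UNIV" for w
      by (rule abs_summable_summable[OF theta_term_abs_summable[OF G p \<beta>]])
  qed (use deriv in auto)
  moreover have "(\<Sum>\<^sub>\<infinity>n. ?u' n z h) = (Re h * (2 * pi * \<i>)) * theta_sum \<beta> (Suc i) G z + Im h * theta_sum \<beta> i (Cp_deriv G) z" for h
    unfolding theta_sum_def infsum_cmult_right'[symmetric]
    by (intro infsum_add summable_on_cmult_right)
       (auto intro!: abs_summable_summable theta_term_abs_summable[OF _ p \<beta>] G G')
  ultimately show ?thesis
    by (simp add: theta_sum_def[abs_def])
qed

text \<open>A directional derivative of a theta series is a linear combination of two theta series,
  one with \<open>i\<close> raised and one with \<open>G\<close> differentiated; hence both are
  generalised in the induction.\<close>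

lemma smooth_theta_sum:
  assumes G: "G \<in> schwartz_Cp p" and p: "1 \<le> p" and \<beta>: "0 < \<beta>"
  shows "smooth (theta_sum \<beta> i G)"
proof -
  have "Ck k (theta_sum \<beta> i G)" for k
    using G
  proof (induction k arbitrary: i G)
    case 0
    then have "theta_sum \<beta> i G differentiable (at z)" for z
      using theta_sum_has_derivative[OF _ p \<beta>] differentiableI by blast
    then show ?case
      by (simp add: continuous_at_imp_continuous_on differentiable_imp_continuous_within)
  next
    case (Suc k)
    note deriv = theta_sum_has_derivative[OF Suc.prems p \<beta>, of i]
    have "Ck k (\<lambda>z. frechet_derivative (theta_sum \<beta> i G) (at z) v)" for v
      unfolding frechet_derivative_at[OF deriv, symmetric]
      by (intro Ck_add Ck_mult_const Suc.IH Suc.prems Cp_deriv_schwartz_Cp)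
    then show ?case
      using differentiableI[OF deriv] by simp
  qed
  then show ?thesis by (simp add: smooth_def)
qed

lemma theta_sum_has_sum:
  assumes "g \<in> schwartz_Cp p" "1 \<le> p" "0 < \<beta>"
  shows "((\<lambda>n. theta_term \<beta> i g n z) has_sum theta_sum \<beta> i g z) UNIV"
  unfolding theta_sum_def
  by (rule has_sum_infsum[OF abs_summable_summable[OF theta_term_abs_summable[OF assms]]])

section \<open>The maps \<open>phi\<close> and \<open>phi_inv\<close> on theta series\<close>

lemma phi_graph_iff:
  "phi_graph \<tau> p f g \<longleftrightarrow> f \<in> F_space \<tau> p \<and> g \<in> schwartz_Cp p
     \<and> (\<forall>(x::real) y. ((\<lambda>n::int. cis2pi (n * x) * g (n, y + n * Im \<tau> / p)) has_sum f (Complex x y)) UNIV)"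
  by (simp add: phi_graph_def cis2pi_def mult.assoc)

text \<open>Quasi-periodicity is the reindexing of the sum by \<open>n + p\<close>: adding
  \<open>\<tau>\<close> moves y by \<open>p\<close> times \<open>Im \<tau> / p\<close>, and
  \<open>g\<close> is \<open>p\<close>-periodic in its index. The factor left over is the required
  phase.\<close>

lemma phi_graph_theta_sum:
  assumes g: "g \<in> schwartz_Cp p" and p: "1 \<le> p" and \<tau>: "Re \<tau> = 0" "0 < Im \<tau>"
  shows "phi_graph \<tau> p (theta_sum (Im \<tau> / p) 0 g) g"
proof -
  let ?\<beta> = "Im \<tau> / p"
  have \<beta>: "0 < ?\<beta>" using p \<tau> by simp
  have "theta_sum ?\<beta> 0 g (z + 1) = theta_sum ?\<beta> 0 g z" for z
    by (simp add: theta_sum_def theta_term_def distrib_left)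
  moreover have "theta_sum ?\<beta> 0 g (z + \<tau>) = exp (- (2 * pi * \<i> * p * Re z)) * theta_sum ?\<beta> 0 g z" for z
  proof -
    have exp: "exp (- (2 * pi * \<i> * p * Re z)) = cis2pi (- (p * Re z))"
      by (simp add: cis2pi_def mult_ac)
    have "theta_term ?\<beta> 0 g n (z + \<tau>) = exp (- (2 * pi * \<i> * p * Re z)) * theta_term ?\<beta> 0 g (n + p) z" for n
    proof -
      have phase: "cis2pi (n * Re z) = cis2pi (- (p * Re z)) * cis2pi ((n + p) * Re z)"
        by (simp add: cis2pi_add[symmetric] algebra_simps)
      have arg: "Im z + Im \<tau> + n * ?\<beta> = Im z + (n + p) * ?\<beta>"
        using p by (simp add: field_simps)
      have per: "g (n, t) = g (n + p, t)" for t
        using schwartz_Cp_periodic[OF g] by simp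
      have "theta_term ?\<beta> 0 g n (z + \<tau>) = cis2pi (n * Re z) * g (n, Im z + Im \<tau> + n * ?\<beta>)"
        using \<tau> by (simp add: theta_term_def)
      also have "\<dots> = cis2pi (- (p * Re z)) * (cis2pi ((n + p) * Re z) * g (n + p, Im z + (n + p) * ?\<beta>))"
        by (simp only: phase arg per[of "Im z + (n + p) * ?\<beta>"] mult.assoc)
      finally show ?thesis
        unfolding exp by (simp add: theta_term_def)
    qed
    then have "theta_sum ?\<beta> 0 g (z + \<tau>) =
        exp (- (2 * pi * \<i> * p * Re z)) * (\<Sum>\<^sub>\<infinity>n. theta_term ?\<beta> 0 g (n + p) z)"
      by (simp add: theta_sum_def infsum_cmult_right')
    also have "(\<Sum>\<^sub>\<infinity>n. theta_term ?\<beta> 0 g (n + p) z) = theta_sum ?\<beta> 0 g z"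
      unfolding theta_sum_def
      by (rule infsum_reindex_bij_betw) (simp add: bij_plus_right)
    finally show ?thesis .
  qed
  ultimately show ?thesis
    using theta_sum_has_sum[OF g p \<beta>, of 0 "Complex _ _"] smooth_theta_sum[OF g p \<beta>] g
    by (simp add: phi_graph_iff F_space_def theta_term_def)
qed

lemma phi_inv_eq_theta_sum:
  assumes g: "g \<in> schwartz_Cp p" and p: "1 \<le> p" and \<tau>: "Re \<tau> = 0" "0 < Im \<tau>"
  shows "phi_inv \<tau> p g = theta_sum (Im \<tau> / p) 0 g"
  unfolding phi_inv_def
proof (rule the_equality)
  show graph: "phi_graph \<tau> p (theta_sum (Im \<tau> / p) 0 g) g"
    by (rule phi_graph_theta_sum[OF assms])
  fix f assume "phi_graph \<tau> p f g"
  with graph have "f (Complex x y) = theta_sum (Im \<tau> / p) 0 g (Complex x y)" for x y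
    unfolding phi_graph_def using has_sum_unique by blast
  then have "f z = theta_sum (Im \<tau> / p) 0 g z" for z
    by (cases z) simp
  then show "f = theta_sum (Im \<tau> / p) 0 g" ..
qed

text \<open>Two families with the same theta series have, at each fixed y, the same Fourier series
  in x.\<close>

lemma phi_theta_sum:
  assumes g: "g \<in> schwartz_Cp p" and p: "1 \<le> p" and \<tau>: "Re \<tau> = 0" "0 < Im \<tau>"
  shows "phi \<tau> p (theta_sum (Im \<tau> / p) 0 g) = g"
  unfolding phi_def
proof (rule the_equality)
  show graph: "phi_graph \<tau> p (theta_sum (Im \<tau> / p) 0 g) g"
    by (rule phi_graph_theta_sum[OF assms])
  fix g' assume graph': "phi_graph \<tau> p (theta_sum (Im \<tau> / p) 0 g) g'"
  have "g' (m, t) = g (m, t)" for m t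
  proof -
    \<comment> \<open>Chosen so that the \<open>m\<close>-th Fourier coefficient is the value of the
      \<open>m\<close>-th component at \<open>t\<close>.\<close>
    define y where "y = t - m * Im \<tau> / p"
    have "((\<lambda>n. cis2pi (n * x) * (g (n, y + n * Im \<tau> / p) - g' (n, y + n * Im \<tau> / p))) has_sum 0) UNIV" for x
    proof -
      have "((\<lambda>n. cis2pi (n * x) * g (n, y + n * Im \<tau> / p)) has_sum theta_sum (Im \<tau> / p) 0 g (Complex x y)) UNIV"
        "((\<lambda>n. cis2pi (n * x) * g' (n, y + n * Im \<tau> / p)) has_sum theta_sum (Im \<tau> / p) 0 g (Complex x y)) UNIV"
        using graph graph' by (simp_all add: phi_graph_iff)
      from has_sum_add[OF this(1) has_sum_uminusI[OF this(2)]] show ?thesis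
        by (simp add: right_diff_distrib)
    qed
    from fourier_coeff_zero[OF this, of m] show ?thesis
      by (simp add: y_def)
  qed
  then show "g' = g" by (auto simp: fun_eq_iff)
qed

section \<open>The transported action\<close>

text \<open>The component form of the explicit operators: \<open>U^m\<close> translates and shifts
  by \<open>m\<close>, then \<open>V^n\<close> contributes e(n t) and the clock phase. For fixed
  \<open>j\<close> that phase is constant in t, so it is folded into the coefficients.\<close>

definition H_act ::
  "real \<Rightarrow> int \<Rightarrow> int \<Rightarrow> (int \<times> int \<Rightarrow> complex) \<Rightarrow> (int \<times> real \<Rightarrow> complex) \<Rightarrow> int \<times> real \<Rightarrow> complex" where
  "H_act \<theta> p s c g = (\<lambda>(j, t). translates_sum (s / p + \<theta>)
     (\<lambda>(m, n). c (m, n) * cis2pi (- (n * j * s / p))) (\<lambda>(m, r). g (j - m, r)) t)"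

lemma rapidly_decreasing_phase:
  assumes "rapidly_decreasing c"
  shows "rapidly_decreasing (\<lambda>(m, n). c (m, n) * cis2pi (x m n))"
proof (rule rapidly_decreasing_mult[OF assms, where A = 1])
  show "cmod (case (m, n) of (m, n) \<Rightarrow> c (m, n) * cis2pi (x m n))
      \<le> 1 * (1 + \<bar>real_of_int m\<bar> + \<bar>real_of_int n\<bar>) * cmod (c (m, n))" for m n
    using mult_right_mono[of 1 "1 + \<bar>real_of_int m\<bar> + \<bar>real_of_int n\<bar>" "cmod (c (m, n))"]
    by (simp add: norm_mult)
qed

lemma schwartz_Cp_reflect:
  assumes "g \<in> schwartz_Cp p"
  shows "(\<lambda>(m, r). g (j - m, r)) \<in> schwartz_Cp p"
proof -
  have "g (j - (m + p), r) = g (j - m, r)" for m r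
    using schwartz_Cp_periodic[OF assms, of "j - (m + p)"] by simp
  then show ?thesis
    using assms by (simp add: schwartz_Cp_def)
qed

text \<open>Raising \<open>j\<close> by \<open>p\<close> changes the phase argument by the integer
  \<open>n * s\<close>. Membership allows \<open>phi\<close> to recover \<open>H_act\<close> from
  its theta series.\<close>

lemma H_act_schwartz_Cp:
  assumes c: "rapidly_decreasing c" and g: "g \<in> schwartz_Cp p" and p: "1 \<le> p"
  shows "H_act \<theta> p s c g \<in> schwartz_Cp p"
proof -
  have "cis2pi (- (n * real_of_int (j + p) * s / p)) = cis2pi (- (n * j * s / p))" for n j :: int
  proof -
    have "- (n * real_of_int (j + p) * s / p) = - (n * j * s / p) - real_of_int (n * s)"
      using p by (simp add: field_simps)
    then show ?thesis by (simp only: cis2pi_diff_of_int)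
  qed
  moreover have "g (j + p - m, r) = g (j - m, r)" for j m r
    using schwartz_Cp_periodic[OF g, of "j - m"] by (simp add: algebra_simps)
  ultimately show ?thesis
    using schwartz_translates_sum[OF rapidly_decreasing_phase[OF c] schwartz_Cp_reflect[OF g] p]
    by (simp add: schwartz_Cp_def H_act_def)
qed

lemma series_action_theta_sum:
  assumes c: "rapidly_decreasing c" and g: "g \<in> schwartz_Cp p" and p: "1 \<le> p"
    and \<beta>: "\<beta> = s / p + \<theta> / 2" "0 < \<beta>"
  shows "series_action (F_U \<theta>) (F_V \<theta>) c (theta_sum \<beta> 0 g) = theta_sum \<beta> 0 (H_act \<theta> p s c g)"
proof -
  have "series_action (F_U \<theta>) (F_V \<theta>) c (theta_sum \<beta> 0 g) (Complex x y)
      = theta_sum \<beta> 0 (H_act \<theta> p s c g) (Complex x y)" for x y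
  proof -
    \<comment> \<open>The part of total frequency \<open>j\<close>: the exponential from
      \<open>U^m\<close> raises the frequency \<open>j - m\<close> of a theta term to
      \<open>j\<close>.\<close>
    define K where "K = (\<lambda>(m, n) j. c (m, n) * (cis2pi (n * y) * (cis2pi (m * (x + n * \<theta> / 2)) *
        theta_term \<beta> 0 g (j - m) (Complex (x + n * \<theta> / 2) (y - m * \<theta> / 2)))))"
    have K_eq: "K (m, n) j = cis2pi (j * x) * translates_term (s / p + \<theta>)
        (\<lambda>(m, n). c (m, n) * cis2pi (- (n * j * s / p))) (\<lambda>(m, r). g (j - m, r)) (m, n) (y + j * \<beta>)" for m n j
    proof -
      \<comment> \<open>Translating x by \<open>n * \<theta> / 2\<close> gives the phase argument
        \<open>n * j * \<theta> / 2\<close>, which is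
        \<open>n * j * \<beta> - n * j * s / p\<close>; this is the origin of the clock
        phase.\<close>
      have phase: "cis2pi (n * y) * (cis2pi (m * (x + n * \<theta> / 2)) * cis2pi ((j - m) * (x + n * \<theta> / 2)))
          = cis2pi (j * x) * (cis2pi (- (n * j * s / p)) * cis2pi (n * (y + j * \<beta>)))"
        unfolding cis2pi_add[symmetric] using p by (intro arg_cong[of _ _ cis2pi]) (simp add: \<beta> field_simps)
      have arg: "y - m * \<theta> / 2 + (j - m) * \<beta> = y + j * \<beta> - m * (s / p + \<theta>)"
        using p by (simp add: \<beta> field_simps)
      have "K (m, n) j = c (m, n) * ((cis2pi (n * y) * (cis2pi (m * (x + n * \<theta> / 2)) *
          cis2pi ((j - m) * (x + n * \<theta> / 2)))) * g (j - m, y - m * \<theta> / 2 + (j - m) * \<beta>))"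
        by (simp add: K_def theta_term_def mult.assoc)
      then show ?thesis
        unfolding phase arg translates_term_def by (simp add: mult_ac)
    qed
    obtain M where M: "M summable_on UNIV" "\<And>n. 0 \<le> M n"
      "\<And>n z. cmod (theta_term \<beta> 0 g n z) \<le> (1 + \<bar>Im z\<bar>) ^ (0 + 2) * M n"
      using theta_term_bound[OF g p \<beta>(2)] by meson
    \<comment> \<open>The theta bound is quadratic in the imaginary part, here shifted by
      \<open>m * \<theta> / 2\<close>; two powers of the weight on \<open>c\<close> absorb this
      growth in \<open>m\<close>.\<close>
    obtain N where N: "N summable_on UNIV"
      "\<And>m n. (1 + \<bar>real_of_int m\<bar> + \<bar>real_of_int n\<bar>) ^ 2 * cmod (c (m, n)) \<le> N (m, n)"
      using rapidly_decreasing_summable_bound[OF c] by meson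
    define B where "B = 1 + \<bar>y\<bar> + \<bar>\<theta>\<bar>"
    have bound: "(\<lambda>((m, n), j). B ^ 2 * N (m, n) * M (j - m)) summable_on UNIV \<times> UNIV"
    proof -
      have "0 \<le> N k" for k
        using order_trans[OF _ N(2)[of "fst k" "snd k"], of 0] by simp
      then have sum: "(\<lambda>(k, j). B ^ 2 * N k * M j) summable_on UNIV \<times> UNIV"
        using M(2) by (intro summable_on_times summable_on_cmult_right N(1) M(1)) simp_all
      \<comment> \<open>This shear carries summability of the product majorant over to the shifted
        index \<open>j - m\<close>.\<close>
      have "bij_betw (\<lambda>(k, j). (k, j - fst k)) (UNIV \<times> UNIV) (UNIV :: ((int \<times> int) \<times> int) set)"
        by (rule bij_betw_byWitness[where f' = "\<lambda>(k, j). (k, j + fst k)"]) auto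
      from summable_on_reindex_bij_betw[OF this, of "\<lambda>(k, j). B ^ 2 * N k * M j"] sum
      show ?thesis by (simp add: case_prod_unfold)
    qed
    have le: "norm (K (m, n) j) \<le> B ^ 2 * N (m, n) * M (j - m)" for m n j
    proof -
      let ?q = "1 + \<bar>real_of_int m\<bar> + \<bar>real_of_int n\<bar>"
      have "1 + \<bar>y - m * \<theta> / 2\<bar> \<le> B * ?q"
      proof -
        have "1 + \<bar>y - m * \<theta> / 2\<bar> \<le> 1 + (\<bar>y\<bar> + \<bar>\<theta>\<bar> * \<bar>real_of_int m\<bar>)"
          using abs_triangle_ineq4[of y "m * \<theta> / 2"] abs_ge_zero[of "m * \<theta>"]
          unfolding abs_divide abs_mult mult.commute[of "\<bar>\<theta>\<bar>"] by linarith
        also have "\<dots> \<le> B * ?q" by (simp add: B_def distrib_left distrib_right)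
        finally show ?thesis .
      qed
      then have sq: "(1 + \<bar>y - m * \<theta> / 2\<bar>) ^ 2 \<le> (B * ?q) ^ 2" by (intro power_mono) auto
      have "norm (K (m, n) j) \<le> cmod (c (m, n)) * ((1 + \<bar>y - m * \<theta> / 2\<bar>) ^ 2 * M (j - m))"
        using mult_left_mono[OF M(3)[of "j - m" "Complex (x + n * \<theta> / 2) (y - m * \<theta> / 2)"], of "cmod (c (m, n))"]
        by (simp add: K_def norm_mult power2_eq_square)
      also have "\<dots> \<le> cmod (c (m, n)) * ((B * ?q) ^ 2 * M (j - m))"
        by (rule mult_left_mono[OF mult_right_mono[OF sq M(2)]]) simp
      also have "\<dots> = B ^ 2 * (?q ^ 2 * cmod (c (m, n))) * M (j - m)"
        by (simp only: power_mult_distrib mult_ac)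
      also have "\<dots> \<le> B ^ 2 * N (m, n) * M (j - m)"
        by (rule mult_right_mono[OF mult_left_mono[OF N(2)] M(2)]) simp
      finally show ?thesis .
    qed
    have "(\<lambda>q. norm (case q of (k, j) \<Rightarrow> K k j)) summable_on UNIV \<times> UNIV"
    proof (rule summable_on_comparison_test[OF bound])
      fix q :: "(int \<times> int) \<times> int"
      obtain m n j where q: "q = ((m, n), j)" by (metis prod.exhaust)
      show "norm (case q of (k, j) \<Rightarrow> K k j) \<le> (\<lambda>((m, n), j). B ^ 2 * N (m, n) * M (j - m)) q"
        using le[of m n j] by (simp only: q prod.case)
    qed (rule norm_ge_zero)
    then have K: "(\<lambda>(k, j). K k j) summable_on UNIV \<times> UNIV"
      by (rule abs_summable_summable)
    have "series_action (F_U \<theta>) (F_V \<theta>) c (theta_sum \<beta> 0 g) (Complex x y) = (\<Sum>\<^sub>\<infinity>k. \<Sum>\<^sub>\<infinity>j. K k j)"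
      unfolding series_action_def
    proof (rule infsum_cong)
      fix k :: "int \<times> int"
      obtain m n where k: "k = (m, n)" by (cases k)
      have "(\<Sum>\<^sub>\<infinity>j. theta_term \<beta> 0 g (j - m) z) = theta_sum \<beta> 0 g z" for z
        unfolding theta_sum_def
        by (rule infsum_reindex_bij_betw[where g = "\<lambda>j. j - m"]) (simp add: bij_diff_right)
      then show "(case k of (m, n) \<Rightarrow> c (m, n) * bij_power (F_V \<theta>) n (bij_power (F_U \<theta>) m (theta_sum \<beta> 0 g)) (Complex x y))
          = (\<Sum>\<^sub>\<infinity>j. K k j)"
        by (simp add: k K_def bij_power_F_U bij_power_F_V infsum_cmult_right')
    qed
    \<comment> \<open>Fubini for the absolutely summable triple series; the inner sum now collects a
      single frequency.\<close>
    also have "\<dots> = (\<Sum>\<^sub>\<infinity>j. \<Sum>\<^sub>\<infinity>k. K k j)"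
      by (rule infsum_swap_banach[OF K])
    also have "\<dots> = theta_sum \<beta> 0 (H_act \<theta> p s c g) (Complex x y)"
      unfolding theta_sum_def
    proof (rule infsum_cong)
      fix j
      have "(\<Sum>\<^sub>\<infinity>k. K k j) = (\<Sum>\<^sub>\<infinity>k. cis2pi (j * x) * translates_term (s / p + \<theta>)
        (\<lambda>(m, n). c (m, n) * cis2pi (- (n * j * s / p))) (\<lambda>(m, r). g (j - m, r)) k (y + j * \<beta>))"
        by (intro infsum_cong) (auto simp: K_eq)
      then show "(\<Sum>\<^sub>\<infinity>k. K k j) = theta_term \<beta> 0 (H_act \<theta> p s c g) j (Complex x y)"
        by (simp add: theta_term_def H_act_def translates_sum_def infsum_cmult_right')
    qed
    finally show ?thesis .
  qed
  then show ?thesis by (intro ext) (metis complex.exhaust)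
qed

lemma mact_H_module:
  assumes a: "a \<in> smooth_subalgebra A U V" and g: "g \<in> schwartz_Cp p" and p: "1 \<le> p"
    and \<tau>: "\<tau> = \<i> * complex_of_real (real_of_int s + real_of_int p * \<theta> / 2)" "0 < Im \<tau>"
  shows "mact (H_module A U V \<theta> \<tau> p) g a = H_act \<theta> p s (coeffs A U V a) g"
proof -
  \<comment> \<open>\<open>coeffs\<close> is a choice; membership of \<open>a\<close> in the smooth
    subalgebra supplies the witness that makes it rapidly decreasing.\<close>
  have c: "rapidly_decreasing (coeffs A U V a)"
    using a someI_ex[of "\<lambda>c. rapidly_decreasing c \<and> series_sum A U V c a"]
    by (auto simp: smooth_subalgebra_def coeffs_def)
  have \<tau>': "Re \<tau> = 0" using \<tau> by simp
  have "Im \<tau> / p = s / p + \<theta> / 2" "0 < Im \<tau> / p"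
    using \<tau>(2) p unfolding \<tau>(1) by (simp_all add: field_simps)
  from series_action_theta_sum[OF c g p this] show ?thesis
    using phi_inv_eq_theta_sum[OF g p \<tau>' \<tau>(2)] phi_theta_sum[OF H_act_schwartz_Cp[OF c g p] p \<tau>' \<tau>(2)]
    by (simp add: H_module_def F_module_def)
qed

lemma mact_heisenberg_module:
  "mact (heisenberg_module A U V \<theta> p s) \<psi> a (k, t) =
     (\<Sum>\<^sub>\<infinity>(m, n)\<in>UNIV. coeffs A U V a (m, n) *
        (cis2pi (n * (t + k / p)) * \<psi> (k + m * s, t - m * (s / p + \<theta>))))"
  by (simp add: heisenberg_module_def series_action_def bij_power_E_U bij_power_E_V)

section \<open>The intertwiner\<close>

text \<open>The two minus signs cancel, so the composite multiplies the index by
  \<open>s * s'\<close>, which is 1 modulo \<open>p\<close>. The Bezout relation is symmetric in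
  \<open>s\<close> and \<open>s'\<close>, so this gives inverses on both sides.\<close>

lemma T_op_comp_inverse:
  assumes "w \<in> Cvec p" and s': "s * s' + p * v = 1"
  shows "T_op p s (T_op p s' w) = w"
proof
  fix n
  have "((- s') * ((- s * n) mod p)) mod p = (s * s' * n) mod p"
    by (simp only: mod_mult_right_eq) (simp add: mult_ac)
  also have "s * s' * n = n + p * (- (v * n))"
  proof -
    have "s * s' = 1 - p * v" using s' by linarith
    then show ?thesis by (simp add: left_diff_distrib)
  qed
  also have "\<dots> mod p = n mod p" by (rule mod_mult_self2)
  finally show "T_op p s (T_op p s' w) n = w n"
    using assms(1) periodic_mod[of w p n] by (simp add: T_op_def Cvec_def)
qed

lemma T_op_add_period: "T_op p s w (n + p) = T_op p s w n"
  by (simp only: T_op_def distrib_left mod_mult_self1)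

lemma T_op_Cvec: "T_op p s w \<in> Cvec p"
  by (simp add: Cvec_def T_op_add_period)

lemma Cvec_invertible_T_op:
  assumes "coprime p s"
  shows "Cvec_invertible p (T_op p s)"
proof -
  obtain s' v where s': "s * s' + p * v = 1"
    using bezout_int[of s p] assms by (auto simp: coprime_iff_gcd_eq_1 gcd.commute mult.commute)
  then have s'': "s' * s + p * v = 1" by (simp add: mult.commute)
  have "Cvec_linear p (T_op p s)"
    by (simp add: Cvec_linear_def T_op_Cvec) (simp add: T_op_def fun_eq_iff)
  moreover have "bij_betw (T_op p s) (Cvec p) (Cvec p)"
    by (rule bij_betw_byWitness[where f' = "T_op p s'"])
       (use T_op_comp_inverse[OF _ s'] T_op_comp_inverse[OF _ s''] T_op_Cvec in auto)
  ultimately show ?thesis by (simp add: Cvec_invertible_def)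
qed

text \<open>Multiplication by \<open>-s\<close> permutes the residues modulo \<open>p\<close>, so
  the inner product is merely reindexed.\<close>

lemma Cvec_unitary_T_op:
  assumes p: "1 \<le> p" and cop: "coprime p s"
  shows "Cvec_unitary p (T_op p s)"
proof -
  have inj: "inj_on (\<lambda>n. (- s * n) mod p) {0..<p}"
  proof (rule inj_onI)
    fix m n assume mn: "m \<in> {0..<p}" "n \<in> {0..<p}" "(- s * m) mod p = (- s * n) mod p"
    then have "p dvd (- s) * (m - n)"
      by (simp add: mod_eq_dvd_iff right_diff_distrib)
    then have "p dvd m - n"
      using cop by (simp add: coprime_dvd_mult_right_iff)
    then show "m = n"
      using mn by (metis atLeastLessThan_iff mod_eq_dvd_iff mod_pos_pos_trivial)
  qed
  have bij: "bij_betw (\<lambda>n. (- s * n) mod p) {0..<p} {0..<p}"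
    unfolding bij_betw_def
    using inj p by (intro conjI inj endo_inj_surj) auto
  have "Cvec_inner p (T_op p s v) (T_op p s w) = Cvec_inner p v w" for v w
    unfolding Cvec_inner_def T_op_def
    using sum.reindex_bij_betw[OF bij, of "\<lambda>n. cnj (v n) * w n"] .
  then show ?thesis
    using Cvec_invertible_T_op[OF cop] by (simp add: Cvec_unitary_def)
qed

lemma tensor_op_id_T_op: "tensor_op id (T_op p s) \<psi> (j, t) = \<psi> ((- s * j) mod p, t)"
  by (simp add: tensor_op_def T_op_def)

lemma tensor_op_T_op_eq:
  "\<psi> \<in> schwartz_Cp p \<Longrightarrow> tensor_op id (T_op p s) \<psi> (j, t) = \<psi> (- s * j, t)"
  by (simp only: tensor_op_id_T_op schwartz_Cp_mod)

lemma tensor_op_T_op_schwartz_Cp: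
  "\<psi> \<in> schwartz_Cp p \<Longrightarrow> tensor_op id (T_op p s) \<psi> \<in> schwartz_Cp p"
  using T_op_add_period by (auto simp: schwartz_Cp_def tensor_op_def) (simp add: T_op_def)

lemma bij_betw_tensor_op_T_op:
  assumes "coprime p s"
  shows "bij_betw (tensor_op id (T_op p s)) (schwartz_Cp p) (schwartz_Cp p)"
proof -
  obtain s' v where s': "s * s' + p * v = 1"
    using bezout_int[of s p] assms by (auto simp: coprime_iff_gcd_eq_1 gcd.commute mult.commute)
  have inv: "tensor_op id (T_op p a) (tensor_op id (T_op p b) \<psi>) = \<psi>"
    if "a * b + p * v = 1" "\<psi> \<in> schwartz_Cp p" for a b \<psi>
  proof -
    \<comment> \<open>At each fixed \<open>t\<close> only the vector of residues is involved, which
      reduces the claim to \<open>T_op_comp_inverse\<close>.\<close>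
    have "tensor_op id (T_op p a) (tensor_op id (T_op p b) \<psi>) (j, t) = T_op p a (T_op p b (\<lambda>k. \<psi> (k, t))) j" for j t
      by (simp add: tensor_op_def T_op_def)
    moreover have "(\<lambda>k. \<psi> (k, t)) \<in> Cvec p" for t
      using that by (simp add: schwartz_Cp_def Cvec_def)
    ultimately show ?thesis
      using T_op_comp_inverse[OF _ that(1)] by (auto simp: fun_eq_iff)
  qed
  show ?thesis
    by (rule bij_betw_byWitness[where f' = "tensor_op id (T_op p s')"])
       (use inv[OF s'] inv[of s' s] s' tensor_op_T_op_schwartz_Cp in \<open>auto simp: mult.commute\<close>)
qed

text \<open>Evaluating at the residue of \<open>- s * j\<close> turns the clock phase into e(- n j s
  / p), and the index shift by \<open>m * s\<close> into \<open>- s * (j - m)\<close>. The two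
  series then agree term by term.\<close>

lemma tensor_op_T_op_heisenberg_act:
  assumes \<psi>: "\<psi> \<in> schwartz_Cp p" and p: "1 \<le> p"
  shows "tensor_op id (T_op p s) (mact (heisenberg_module A U V \<theta> p s) \<psi> a) =
    H_act \<theta> p s (coeffs A U V a) (tensor_op id (T_op p s) \<psi>)"
proof -
  let ?c = "coeffs A U V a"
  have "tensor_op id (T_op p s) (mact (heisenberg_module A U V \<theta> p s) \<psi> a) (j, t) =
    H_act \<theta> p s ?c (tensor_op id (T_op p s) \<psi>) (j, t)" for j t
  proof -
    let ?k = "(- s * j) mod p"
    have "?c (m, n) * (cis2pi (n * (t + ?k / p)) * \<psi> (?k + m * s, r)) =
      ?c (m, n) * cis2pi (- (n * j * s / p)) * cis2pi (n * t) * tensor_op id (T_op p s) \<psi> (j - m, r)" for m n r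
    proof -
      \<comment> \<open>Reducing \<open>- s * j\<close> modulo \<open>p\<close> subtracts a multiple
        of \<open>p\<close>, which alters the phase argument only by an integer.\<close>
      have "n * (t + real_of_int (- s * j - p * q) / p) = - (n * j * s / p) + n * t - real_of_int (n * q)" for q
        using p by (simp add: field_simps)
      then have "n * (t + ?k / p) = - (n * j * s / p) + n * t - real_of_int (n * ((- s * j) div p))"
        by (simp only: minus_mult_div_eq_mod[symmetric])
      then have "cis2pi (n * (t + ?k / p)) = cis2pi (- (n * j * s / p)) * cis2pi (n * t)"
        by (simp only: cis2pi_diff_of_int cis2pi_add)
      moreover have "\<psi> (?k + m * s, r) = \<psi> (- s * (j - m), r)"
      proof -
        have "\<psi> (?k + m * s, r) = \<psi> ((?k + m * s) mod p, r)"
          by (rule schwartz_Cp_mod[OF \<psi>, symmetric])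
        also have "(?k + m * s) mod p = (- s * j + m * s) mod p"
          by (rule mod_add_left_eq)
        also have "- s * j + m * s = - s * (j - m)"
          by (simp add: algebra_simps)
        also have "\<psi> ((- s * (j - m)) mod p, r) = \<psi> (- s * (j - m), r)"
          by (rule schwartz_Cp_mod[OF \<psi>])
        finally show ?thesis .
      qed
      ultimately show ?thesis
        by (simp only: tensor_op_T_op_eq[OF \<psi>] mult.assoc)
    qed
    then show ?thesis
      by (simp only: tensor_op_id_T_op mact_heisenberg_module H_act_def translates_sum_def
          translates_term_def case_prod_unfold fst_conv snd_conv prod.collapse)
  qed
  then show ?thesis by (auto simp: fun_eq_iff)
qed

text \<open>For \<open>p = 1\<close> all components coincide, so the index shift is invisible, and
  the clock phases have integer argument.\<close>

lemma H_act_eq_heisenberg_act: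
  assumes \<psi>: "\<psi> \<in> schwartz_Cp 1"
  shows "H_act \<theta> 1 0 (coeffs A U V a) \<psi> = mact (heisenberg_module A U V \<theta> 1 0) \<psi> a"
proof -
  have per: "\<psi> (n, t) = \<psi> (0, t)" for n t
    using schwartz_Cp_mod[OF \<psi>, of n t] by simp
  have "H_act \<theta> 1 0 (coeffs A U V a) \<psi> (j, t) = mact (heisenberg_module A U V \<theta> 1 0) \<psi> a (j, t)" for j t
  proof -
    have "cis2pi (n * (t + j)) = cis2pi (n * t)" for n :: int
      using cis2pi_add_of_int[of "n * t" "n * j"] by (simp add: distrib_left)
    then show ?thesis
      by (simp add: H_act_def translates_sum_def translates_term_def mact_heisenberg_module
          case_prod_unfold per[of "_ - _"] per[of j] mult.assoc)
  qed
  then show ?thesis by (auto simp: fun_eq_iff)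
qed

text \<open>Coprimality makes \<open>T_op\<close> a permutation of residues, which upgrades the
  intertwining identity to an isomorphism. Both actions are compared through
  \<open>H_act\<close>.\<close>

theorem mainTheorem3:
  fixes A :: "'a cstar" and U V :: 'a and \<theta> :: real and p s :: int and \<tau> :: complex
  assumes A: "is_rotation_algebra \<theta> A U V"
    and \<theta>: "0 \<le> \<theta>" "\<theta> < 1"
    and p: "1 \<le> p"
    and \<tau>: "\<tau> = \<i> * complex_of_real (real_of_int s + real_of_int p * \<theta> / 2)"
    and Im_\<tau>: "0 < Im \<tau>"
  shows "(s \<noteq> 0 \<and> coprime p s \<longrightarrow>
            Cvec_invertible p (T_op p s) \<and> Cvec_unitary p (T_op p s) \<and>
            rmodule_iso (smooth_subalgebra A U V)
              (heisenberg_module A U V \<theta> p s) (H_module A U V \<theta> \<tau> p)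
              (tensor_op id (T_op p s)))
       \<and> (s = 0 \<and> p = 1 \<longrightarrow>
            rmodule_coincide (smooth_subalgebra A U V)
              (H_module A U V \<theta> \<tau> p) (heisenberg_module A U V \<theta> p s))"
proof (intro conjI impI; elim conjE)
  assume cop: "coprime p s"
  show "Cvec_invertible p (T_op p s)" "Cvec_unitary p (T_op p s)"
    using Cvec_invertible_T_op[OF cop] Cvec_unitary_T_op[OF p cop] by simp_all
  have carriers: "mcarrier (heisenberg_module A U V \<theta> p s) = schwartz_Cp p"
    "mcarrier (H_module A U V \<theta> \<tau> p) = schwartz_Cp p"
    by (simp_all add: heisenberg_module_def H_module_def)
  have "tensor_op id (T_op p s) (mact (heisenberg_module A U V \<theta> p s) \<psi> a) =
      mact (H_module A U V \<theta> \<tau> p) (tensor_op id (T_op p s) \<psi>) a"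
    if "\<psi> \<in> schwartz_Cp p" "a \<in> smooth_subalgebra A U V" for \<psi> a
    using tensor_op_T_op_heisenberg_act[OF that(1) p] that
      mact_H_module[OF that(2) tensor_op_T_op_schwartz_Cp p \<tau> Im_\<tau>] by simp
  moreover have "tensor_op id (T_op p s) (madd (heisenberg_module A U V \<theta> p s) \<psi> \<phi>) =
      madd (H_module A U V \<theta> \<tau> p) (tensor_op id (T_op p s) \<psi>) (tensor_op id (T_op p s) \<phi>)" for \<psi> \<phi>
    by (auto simp: heisenberg_module_def H_module_def tensor_op_id_T_op fun_eq_iff)
  moreover have "tensor_op id (T_op p s) (mscale (heisenberg_module A U V \<theta> p s) c \<psi>) =
      mscale (H_module A U V \<theta> \<tau> p) c (tensor_op id (T_op p s) \<psi>)" for c \<psi>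
    by (auto simp: heisenberg_module_def H_module_def tensor_op_id_T_op fun_eq_iff)
  ultimately show "rmodule_iso (smooth_subalgebra A U V) (heisenberg_module A U V \<theta> p s)
      (H_module A U V \<theta> \<tau> p) (tensor_op id (T_op p s))"
    unfolding rmodule_iso_def carriers using bij_betw_tensor_op_T_op[OF cop] by blast
next
  assume s: "s = 0" and p1: "p = 1"
  have "mact (H_module A U V \<theta> \<tau> p) \<psi> a = mact (heisenberg_module A U V \<theta> p s) \<psi> a"
    if "\<psi> \<in> schwartz_Cp p" "a \<in> smooth_subalgebra A U V" for \<psi> a
    using mact_H_module[OF that(2,1) p \<tau> Im_\<tau>] H_act_eq_heisenberg_act that(1) s p1 by simp
  then show "rmodule_coincide (smooth_subalgebra A U V) (H_module A U V \<theta> \<tau> p)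
      (heisenberg_module A U V \<theta> p s)"
    by (simp add: rmodule_coincide_def) (simp add: heisenberg_module_def H_module_def)
qed

end
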